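(* Assume that the noise satisfies the following two conditions. (i) The vector $\zeta^*(n)=(\zeta_1^*(n),\ldots,\zeta_p^*(n))'$ with components $\zeta^*_l(n)=\frac1{\sqrt n}\sum_{j=1}^{np}\phi_l(t_j)\,\Delta\xi_{t_j}$, $\Delta\xi_{t_j}=\xi_{t_j}-\xi_{t_{j-1}}$, is Gaussian with non-degenerate covariance matrix $B^*_{n,p}=\mathbf E\,\zeta^*(n)(\zeta^*(n))'$. (ii) $\sup_{n\ge1}\sup_{p\ge1}\lambda_{\max}(B^*_{n,p})\le\lambda^*$, where $\lambda_{\max}$ is the maximal eigenvalue and $\lambda^*$ is a known positive constant. Then the estimator $\widetilde S_{\widetilde m_p,p}$ satisfies the oracle inequality $$\mathbf E_S\|\widetilde S_{\widetilde m_p,p}-S\|_p^2\le\inf_{m\in\mathcal M_p}\widetilde a_{m,p}(S)+8H_p(S)+\frac{2\tau_0\lambda^*}{n},$$ where $$\widetilde a_{m,p}(S)=7\,\mathbf E_S\|\widetilde S_{m,p}-S\|_p^2+32\lambda^*z_*\frac{l_md_m}{n},\qquad\tau_0=\frac{16\,l^*z_*}{z_*-1}.$$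
   Context: Model: $dy_t=S(t)\,dt+d\xi_t$, where $S$ is an unknown $1$-periodic function, square integrable on $[0,1]$, and $(\xi_t)_{t\ge0}$ is a continuous zero-mean Gaussian process. The observations are $(y_{t_j})_{0\le j\le np}$ with $t_j=j/p$, where $n\ge1$ is an integer and $p$ is a given odd number (conditions involving all $p$ refer to odd positive integers $p$, with the basis below fixed for each $p$). $\Delta y_{t_k}=y_{t_k}-y_{t_{k-1}}$ and $\Delta t_k=1/p$. $\mathbf E_S$ denotes expectation under the law of $y$ given $S$. $\mathcal X_p$ is the set of $1$-periodic functions $x:\mathbb R\to\mathbb R$ with scalar product $(x,z)_p=\frac1p\sum_{j=1}^px(t_j)z(t_j)$ and $\|x\|_p^2=(x,x)_p$ (functions being compared through their values at the points $t_1,\ldots,t_p$). $(\phi_j)_{1\le j\le p}$ is an orthonormal basis of $\mathcal X_p$. $\mathcal M_p$ is some set of subsets of $\{1,\ldots,p\}$. For $m\in\mathcal M_p$, $\mathcal D_{m,p}=\{\sum_{j\in m}\lambda_j\phi_j:\lambda_j\in\mathbb R\}$ and $d_m$ is the number of elements of $m$. $(\widetilde S_{m,p})_{m\in\mathcal M_p}$ is any family of projective estimators, i.e. each $\widetilde S_{m,p}$ is a measurable function of $(y_{t_j})_{0\le j\le np}$ with values in $\mathcal D_{m,p}$. The weights satisfy $l_m\ge1$, and $l^*=\sum_{m\in\mathcal M_p}e^{-l_md_m}$. The number $z_*\approx3.1462$ is the maximal root of $\ln z=z-2$. The penalty is $P_n(m)=\rho\frac{l_md_m}{n}$ with $\rho=4\lambda^*\frac{z_*^2}{z_*-1}$.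 The contrast is $\gamma_{n,p}(x)=\|x\|_p^2-\frac2n\sum_{k=1}^{np}x(t_k)\Delta y_{t_k}$. The selected index is $\widetilde m_p=\operatorname{argmin}_{m\in\mathcal M_p}\{\gamma_{n,p}(\widetilde S_{m,p})+P_n(m)\}$. Discretization error: $H_p(S)=\frac1p\sum_{l=1}^ph_l^2(S)$ with $h_l(S)=\frac1{\Delta t_l}\int_{t_{l-1}}^{t_l}(S(t)-S(t_l))\,dt$. *)

theory Defs
  imports "HOL-Probability.Probability" "Jordan_Normal_Form.Char_Poly"
begin

definition periodic_one :: "(real \<Rightarrow> real) \<Rightarrow> bool" where
  "periodic_one x \<longleftrightarrow> (\<forall>t. x (t + 1) = x t)"

definition square_integrable_unit :: "(real \<Rightarrow> real) \<Rightarrow> bool" where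
  "square_integrable_unit S \<longleftrightarrow>
     set_borel_measurable lebesgue {0..1} S \<and> set_integrable lebesgue {0..1} (\<lambda>t. (S t)\<^sup>2)"

text \<open>A real Gaussian variable may be degenerate (almost surely constant).\<close>

definition gaussian_rv :: "'a measure \<Rightarrow> ('a \<Rightarrow> real) \<Rightarrow> bool" where
  "gaussian_rv M X \<longleftrightarrow> X \<in> borel_measurable M \<and>
     ((\<exists>\<mu>. AE \<omega> in M. X \<omega> = \<mu>) \<or>
      (\<exists>\<mu> \<sigma>. 0 < \<sigma> \<and> distributed M lborel X (\<lambda>x. ennreal (normal_density \<mu> \<sigma> x))))"

text \<open>For finite \<open>I\<close> this says that \<open>(X i)\<close>, \<open>i \<in> I\<close>, is a Gaussian vector; for general \<open>I\<close>,
  that it is a Gaussian process.\<close>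

definition jointly_gaussian :: "'a measure \<Rightarrow> 'i set \<Rightarrow> ('i \<Rightarrow> 'a \<Rightarrow> real) \<Rightarrow> bool" where
  "jointly_gaussian M I X \<longleftrightarrow>
     (\<forall>J c. finite J \<and> J \<subseteq> I \<longrightarrow> gaussian_rv M (\<lambda>\<omega>. \<Sum>i\<in>J. c i * X i \<omega>))"

definition gaussian_noise :: "'a measure \<Rightarrow> (real \<Rightarrow> 'a \<Rightarrow> real) \<Rightarrow> bool" where
  "gaussian_noise M \<xi> \<longleftrightarrow>
     jointly_gaussian M {0..} \<xi> \<and>
     (\<forall>t\<ge>0. (\<integral>\<omega>. \<xi> t \<omega> \<partial>M) = 0) \<and>
     (AE \<omega> in M. continuous_on {0..} (\<lambda>t. \<xi> t \<omega>))"

text \<open>\<open>dy = S dt + d\<xi>\<close> in integrated form; the initial value \<open>y 0\<close> is an arbitrary random variable.\<close>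

definition regression_model ::
  "'a measure \<Rightarrow> (real \<Rightarrow> real) \<Rightarrow> (real \<Rightarrow> 'a \<Rightarrow> real) \<Rightarrow> (real \<Rightarrow> 'a \<Rightarrow> real) \<Rightarrow> bool" where
  "regression_model M S \<xi> y \<longleftrightarrow>
     (\<forall>t\<ge>0. y t \<in> borel_measurable M) \<and>
     (AE \<omega> in M. \<forall>t\<ge>0. y t \<omega> = y 0 \<omega> + (LINT s:{0..t}|lebesgue. S s) + (\<xi> t \<omega> - \<xi> 0 \<omega>))"

definition grid :: "nat \<Rightarrow> nat \<Rightarrow> real" where
  "grid p j = real j / real p"

definition inner_p :: "nat \<Rightarrow> (real \<Rightarrow> real) \<Rightarrow> (real \<Rightarrow> real) \<Rightarrow> real" where
  "inner_p p x z = (1 / real p) * (\<Sum>j=1..p. x (grid p j) * z (grid p j))"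

definition normsq_p :: "nat \<Rightarrow> (real \<Rightarrow> real) \<Rightarrow> real" where
  "normsq_p p x = inner_p p x x"

text \<open>Periodic functions are identified when they agree at the points \<open>grid p 1, \<dots>, grid p p\<close>, so
  the spanning property is only required there.\<close>

definition orthonormal_basis_p :: "nat \<Rightarrow> (nat \<Rightarrow> real \<Rightarrow> real) \<Rightarrow> bool" where
  "orthonormal_basis_p p \<phi> \<longleftrightarrow>
     (\<forall>j\<in>{1..p}. periodic_one (\<phi> j)) \<and>
     (\<forall>i\<in>{1..p}. \<forall>j\<in>{1..p}. inner_p p (\<phi> i) (\<phi> j) = (if i = j then 1 else 0)) \<and>
     (\<forall>x. periodic_one x \<longrightarrow>
        (\<exists>c. \<forall>l\<in>{1..p}. x (grid p l) = (\<Sum>j=1..p. c j * \<phi> j (grid p l))))"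

definition model_space :: "(nat \<Rightarrow> real \<Rightarrow> real) \<Rightarrow> nat set \<Rightarrow> (real \<Rightarrow> real) set" where
  "model_space \<phi> m = {x. \<exists>c. x = (\<lambda>t. \<Sum>j\<in>m. c j * \<phi> j t)}"

definition obs_space :: "nat \<Rightarrow> nat \<Rightarrow> (nat \<Rightarrow> real) measure" where
  "obs_space n p = PiM {0..n * p} (\<lambda>_. borel)"

definition obs :: "nat \<Rightarrow> nat \<Rightarrow> (real \<Rightarrow> 'a \<Rightarrow> real) \<Rightarrow> 'a \<Rightarrow> nat \<Rightarrow> real" where
  "obs n p y \<omega> = (\<lambda>j\<in>{0..n * p}. y (grid p j) \<omega>)"

text \<open>An estimator maps the observation vector to a function.  Elements of \<open>model_space \<phi> m\<close> with
  \<open>m \<subseteq> {1..p}\<close> depend linearly on their values at the grid points, so measurability is that of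
  these values.\<close>

definition projective_estimator ::
  "nat \<Rightarrow> nat \<Rightarrow> (nat \<Rightarrow> real \<Rightarrow> real) \<Rightarrow> nat set \<Rightarrow> ((nat \<Rightarrow> real) \<Rightarrow> real \<Rightarrow> real) \<Rightarrow> bool" where
  "projective_estimator n p \<phi> m T \<longleftrightarrow>
     (\<forall>l\<in>{1..p}. (\<lambda>v. T v (grid p l)) \<in> borel_measurable (obs_space n p)) \<and>
     (\<forall>v\<in>space (obs_space n p). T v \<in> model_space \<phi> m)"

definition zeta ::
  "(nat \<Rightarrow> real \<Rightarrow> real) \<Rightarrow> (real \<Rightarrow> 'a \<Rightarrow> real) \<Rightarrow> nat \<Rightarrow> nat \<Rightarrow> nat \<Rightarrow> 'a \<Rightarrow> real" where
  "zeta \<phi> \<xi> n p l \<omega> =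
     (1 / sqrt (real n)) *
     (\<Sum>j=1..n * p. \<phi> l (grid p j) * (\<xi> (grid p j) \<omega> - \<xi> (grid p (j - 1)) \<omega>))"

text \<open>Matrix indices start at 0, those of \<open>\<phi>\<close> and \<open>zeta\<close> at 1.\<close>

definition cov_mat ::
  "'a measure \<Rightarrow> (nat \<Rightarrow> real \<Rightarrow> real) \<Rightarrow> (real \<Rightarrow> 'a \<Rightarrow> real) \<Rightarrow> nat \<Rightarrow> nat \<Rightarrow> real mat" where
  "cov_mat M \<phi> \<xi> n p =
     mat p p (\<lambda>(i, j). \<integral>\<omega>. zeta \<phi> \<xi> n p (Suc i) \<omega> * zeta \<phi> \<xi> n p (Suc j) \<omega> \<partial>M)"

text \<open>Only applied to real symmetric matrices of positive dimension, whose set of eigenvalues is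
  finite and nonempty.\<close>

definition lambda_max :: "real mat \<Rightarrow> real" where
  "lambda_max A = Max {k. eigenvalue A k}"

definition z_star :: real where
  "z_star = (GREATEST z. 0 < z \<and> ln z = z - 2)"

definition l_star :: "nat set set \<Rightarrow> (nat set \<Rightarrow> real) \<Rightarrow> real" where
  "l_star \<M> l = (\<Sum>m\<in>\<M>. exp (- (l m * real (card m))))"

definition penalty :: "nat \<Rightarrow> real \<Rightarrow> (nat set \<Rightarrow> real) \<Rightarrow> nat set \<Rightarrow> real" where
  "penalty n lam l m =
     (4 * lam * (z_star\<^sup>2 / (z_star - 1))) * (l m * real (card m) / real n)"

definition contrast :: "nat \<Rightarrow> nat \<Rightarrow> (nat \<Rightarrow> real) \<Rightarrow> (real \<Rightarrow> real) \<Rightarrow> real" where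
  "contrast n p v x =
     normsq_p p x - (2 / real n) * (\<Sum>k=1..n * p. x (grid p k) * (v k - v (k - 1)))"

definition discr_h :: "nat \<Rightarrow> (real \<Rightarrow> real) \<Rightarrow> nat \<Rightarrow> real" where
  "discr_h p S l =
     (1 / (1 / real p)) * (LINT t:{grid p (l - 1)..grid p l}|lebesgue. S t - S (grid p l))"

definition discr_H :: "nat \<Rightarrow> (real \<Rightarrow> real) \<Rightarrow> real" where
  "discr_H p S = (1 / real p) * (\<Sum>l=1..p. (discr_h p S l)\<^sup>2)"

text \<open>The quadratic risk may be infinite, hence it is a value in \<open>[0, \<infinity>]\<close>.\<close>

definition risk ::
  "'a measure \<Rightarrow> nat \<Rightarrow> nat \<Rightarrow> (real \<Rightarrow> 'a \<Rightarrow> real) \<Rightarrow> (real \<Rightarrow> real) \<Rightarrow>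
   ((nat \<Rightarrow> real) \<Rightarrow> real \<Rightarrow> real) \<Rightarrow> ennreal" where
  "risk M n p y S T =
     (\<integral>\<^sup>+\<omega>. ennreal (normsq_p p (\<lambda>t. T (obs n p y \<omega>) t - S t)) \<partial>M)"

definition tau_0 :: "nat set set \<Rightarrow> (nat set \<Rightarrow> real) \<Rightarrow> real" where
  "tau_0 \<M> l = 16 * l_star \<M> l * z_star / (z_star - 1)"

end

theory Submission
  imports Defs
begin

text \<open>
  In coordinates with respect to the orthonormal basis the contrast is
  \<open>|x|\<^sup>2 - 2 \<langle>x, S + h + \<nu>\<rangle>\<close>, where \<open>h\<close> is the discretization error and \<open>\<nu> = \<zeta>\<^sup>* / sqrt n\<close>.  Comparing the selected
  \<open>x\<close> with a competitor \<open>w\<close>, whose supports are \<open>m'\<close> and \<open>m\<close>, leaves the cross terms \<open>\<langle>x - w, h\<rangle>\<close> and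
  \<open>\<langle>x - w, \<nu>\<rangle>\<close>.  The constants 7 and 8 are reached by splitting \<open>x - w\<close> along the fixed direction of \<open>h\<close>
  and orthogonally to it: the orthogonal part does not interact with \<open>h\<close>, and along \<open>h\<close> the noise
  is a single Gaussian variable of variance at most \<open>\<lambda>\<^sup>* / n\<close>.  On the orthogonal part the noise is a sum of
  at most \<open>d\<^sub>m + d\<^sub>m\<^sub>'\<close> squares, for which the exponential moment at \<open>s = n (z - 1) / (2 \<lambda>\<^sup>* z)\<close> is
  at most \<open>z\<close> to the power \<open>(d\<^sub>m + d\<^sub>m\<^sub>') / 2\<close>; since \<open>ln z = z - 2\<close> the excess over the penalty has expectation
  of order \<open>exp (- l\<^sub>m\<^sub>' d\<^sub>m\<^sub>')\<close>, which is summed over all \<open>m'\<close>.  The covariance bound enters through the Rayleigh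
  quotient, whose maximum over the unit sphere is an eigenvalue.
\<close>

subsection \<open>Gaussian exponential moments\<close>

text \<open>\<open>GREATEST\<close> only has meaning once a largest root is exhibited. The
  intermediate value theorem gives a root in \<open>[3, 4]\<close>, and beyond it \<open>ln\<close>
  grows strictly slower than the identity, so no later root exists. Afterwards only the equation and
  the lower bound 2 are used.\<close>

lemma z_star_root: "2 \<le> z_star" "ln z_star = z_star - 2"
proof -
  let ?P = "\<lambda>z::real. 0 < z \<and> ln z = z - 2"
  have "\<exists>x\<ge>3. x \<le> 4 \<and> x - 2 - ln x = (0::real)"
  proof (rule IVT')
    have "ln (3::real) = ln (exp 1 * (3 / exp 1))" by simp
    also have "\<dots> = 1 + ln (3 / exp 1)" by (subst ln_mult) auto
    also have "\<dots> \<ge> 1" using exp_le by auto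
    finally show "3 - 2 - ln 3 \<le> (0::real)" by simp
    have "ln (4::real) = 2 * ln 2" using ln_realpow[of 2 2] by simp
    also have "\<dots> \<le> 2" using ln_2_less_1 by simp
    finally show "0 \<le> 4 - 2 - ln (4::real)" by simp
    show "continuous_on {3..4} (\<lambda>x. x - 2 - ln x :: real)"
      by (intro continuous_intros) auto
  qed simp
  then obtain z :: real where z: "3 \<le> z" "ln z = z - 2" by auto
  have "w \<le> z" if "?P w" for w
  proof (rule ccontr)
    assume "\<not> w \<le> z"
    have "ln w - ln z < w - z"
    proof -
      have "ln w - ln z = ln (w / z)" using that z by (simp add: ln_div)
      also have "\<dots> \<le> w / z - 1" using that z by (intro ln_le_minus_one) auto
      also have "\<dots> = (w - z) / z" using z by (simp add: field_simps)
      also have "\<dots> < (w - z) / 1" using z \<open>\<not> w \<le> z\<close> by (intro divide_strict_left_mono) auto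
      finally show ?thesis by simp
    qed
    with that z show False by simp
  qed
  then have "z_star = z"
    unfolding z_star_def using z by (intro Greatest_equality) auto
  with z show "2 \<le> z_star" "ln z_star = z_star - 2" by auto
qed

text \<open>Completing the square: exponential tilting of a centred normal density only shifts its
  mean and multiplies it by a constant, which is the moment generating function.\<close>

lemma exp_mult_normal_density:
  assumes "\<sigma> > 0"
  shows "exp (c * x) * normal_density 0 \<sigma> x = exp (c\<^sup>2 * \<sigma>\<^sup>2 / 2) * normal_density (c * \<sigma>\<^sup>2) \<sigma> x"
proof -
  have "c * x + - (x - 0)\<^sup>2 / (2 * \<sigma>\<^sup>2) = c\<^sup>2 * \<sigma>\<^sup>2 / 2 + - (x - c * \<sigma>\<^sup>2)\<^sup>2 / (2 * \<sigma>\<^sup>2)"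
    using assms by (simp add: field_simps power2_eq_square)
  from arg_cong[OF this, of exp] show ?thesis
    unfolding normal_density_def exp_add by (simp add: mult_ac)
qed

lemma nn_integral_normal_density:
  assumes "\<sigma> > 0"
  shows "(\<integral>\<^sup>+x. ennreal (normal_density \<mu> \<sigma> x) \<partial>lborel) = 1"
  by (subst nn_integral_eq_integral) (use assms in auto)

lemma nn_integral_exp_normal:
  assumes "\<sigma> > 0"
  shows "(\<integral>\<^sup>+x. ennreal (exp (c * x)) * ennreal (normal_density 0 \<sigma> x) \<partial>lborel) = ennreal (exp (c\<^sup>2 * \<sigma>\<^sup>2 / 2))"
proof -
  have "ennreal (exp (c * x)) * ennreal (normal_density 0 \<sigma> x) =
      ennreal (exp (c\<^sup>2 * \<sigma>\<^sup>2 / 2)) * ennreal (normal_density (c * \<sigma>\<^sup>2) \<sigma> x)" for x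
    using exp_mult_normal_density[OF assms, of c x] by (simp flip: ennreal_mult)
  then show ?thesis
    using assms by (simp add: nn_integral_cmult nn_integral_normal_density)
qed

section \<open>Moments of possibly degenerate Gaussian variables\<close>

lemma (in prob_space) gaussian_rv_square_integrable:
  assumes "gaussian_rv M X"
  shows "integrable M X" "integrable M (\<lambda>\<omega>. (X \<omega>)\<^sup>2)"
proof -
  have X [measurable]: "X \<in> borel_measurable M" using assms by (simp add: gaussian_rv_def)
  from assms have "(\<exists>\<mu>. AE \<omega> in M. X \<omega> = \<mu>) \<or>
      (\<exists>\<mu> \<sigma>. 0 < \<sigma> \<and> distributed M lborel X (\<lambda>x. ennreal (normal_density \<mu> \<sigma> x)))"
    by (simp add: gaussian_rv_def)
  then have "integrable M (\<lambda>\<omega>. (X \<omega>)\<^sup>2)"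
  proof (elim disjE exE conjE)
    fix \<mu> assume "AE \<omega> in M. X \<omega> = \<mu>"
    then have "integrable M (\<lambda>\<omega>. (X \<omega>)\<^sup>2) \<longleftrightarrow> integrable M (\<lambda>\<omega>. \<mu>\<^sup>2)"
      by (intro integrable_cong_AE) auto
    then show ?thesis by simp
  next
    fix \<mu> \<sigma> :: real
    assume \<sigma>: "0 < \<sigma>" and D: "distributed M lborel X (\<lambda>x. ennreal (normal_density \<mu> \<sigma> x))"
    \<comment> \<open>The second moment is assembled from the central second moment, the first
      moment and the total mass, using \<open>x\<^sup>2 = (x - \<mu>)\<^sup>2 + 2 * \<mu> * x -
      \<mu>\<^sup>2\<close>.\<close>
    have "integrable lborel (\<lambda>x. normal_density \<mu> \<sigma> x * (x - \<mu>) ^ 2 +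
        2 * \<mu> * (normal_density \<mu> \<sigma> x * x) - \<mu>\<^sup>2 * normal_density \<mu> \<sigma> x)"
      using \<sigma> integrable_normal_moment[OF \<sigma>, of \<mu> 2]
      by (intro Bochner_Integration.integrable_diff Bochner_Integration.integrable_add
          integrable_mult_right integrable_normal_moment_nz_1) auto
    also have "(\<lambda>x. normal_density \<mu> \<sigma> x * (x - \<mu>) ^ 2 +
        2 * \<mu> * (normal_density \<mu> \<sigma> x * x) - \<mu>\<^sup>2 * normal_density \<mu> \<sigma> x) = (\<lambda>x. normal_density \<mu> \<sigma> x * x\<^sup>2)"
      by (auto simp: fun_eq_iff algebra_simps power2_eq_square)
    finally show ?thesis
      using distributed_integrable[OF D, of "\<lambda>x. x\<^sup>2"] by simp
  qed
  then show "integrable M (\<lambda>\<omega>. (X \<omega>)\<^sup>2)" .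
  with X show "integrable M X" by (rule square_integrable_imp_integrable)
qed

text \<open>With mean zero the second moment is the variance. A degenerate variable is then almost
  surely 0 and both sides equal 1; otherwise the tilting identity applies with
  \<open>c = 1\<close>.\<close>

lemma (in prob_space) gaussian_rv_mgf:
  assumes "gaussian_rv M X" "expectation X = 0"
  shows "(\<integral>\<^sup>+\<omega>. ennreal (exp (X \<omega>)) \<partial>M) = ennreal (exp (expectation (\<lambda>\<omega>. (X \<omega>)\<^sup>2) / 2))"
proof -
  have X [measurable]: "X \<in> borel_measurable M" using assms by (simp add: gaussian_rv_def)
  from assms have "(\<exists>\<mu>. AE \<omega> in M. X \<omega> = \<mu>) \<or>
      (\<exists>\<mu> \<sigma>. 0 < \<sigma> \<and> distributed M lborel X (\<lambda>x. ennreal (normal_density \<mu> \<sigma> x)))"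
    by (simp add: gaussian_rv_def)
  then show ?thesis
  proof (elim disjE exE conjE)
    fix \<mu> assume ae: "AE \<omega> in M. X \<omega> = \<mu>"
    then have "expectation X = expectation (\<lambda>_. \<mu>)" by (intro integral_cong_AE) auto
    with assms have [simp]: "\<mu> = 0" by (simp add: prob_space)
    have "expectation (\<lambda>\<omega>. (X \<omega>)\<^sup>2) = expectation (\<lambda>_. 0)"
      using ae by (intro integral_cong_AE) auto
    moreover have "(\<integral>\<^sup>+\<omega>. ennreal (exp (X \<omega>)) \<partial>M) = (\<integral>\<^sup>+\<omega>. 1 \<partial>M)"
      using ae by (intro nn_integral_cong_AE) auto
    ultimately show ?thesis by (simp add: emeasure_space_1)
  next
    fix \<mu> \<sigma> :: real
    assume \<sigma>: "0 < \<sigma>" and D: "distributed M lborel X (\<lambda>x. ennreal (normal_density \<mu> \<sigma> x))"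
    have [simp]: "\<mu> = 0" using normal_distributed_expectation[OF \<sigma> D] assms by simp
    have "expectation (\<lambda>\<omega>. (X \<omega>)\<^sup>2) = \<sigma>\<^sup>2"
      using normal_distributed_variance[OF \<sigma> D] assms by simp
    moreover have "(\<integral>\<^sup>+\<omega>. ennreal (exp (X \<omega>)) \<partial>M) = ennreal (exp (\<sigma>\<^sup>2 / 2))"
      using nn_integral_exp_normal[OF \<sigma>, of 1] distributed_nn_integral[OF D, of "\<lambda>x. ennreal (exp x)"]
      by (simp add: mult.commute)
    ultimately show ?thesis by simp
  qed
qed

text \<open>The integrand is again a multiple of a centred normal density, of variance
  \<open>1 / (1 - 2 * a)\<close>; the multiple, its standard deviation, is the value of the
  integral.\<close>

lemma nn_integral_exp_square_std_normal:
  assumes "2 * a < 1"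
  shows "(\<integral>\<^sup>+g. ennreal (exp (a * g\<^sup>2)) * ennreal (std_normal_density g) \<partial>lborel) =
    ennreal ((1 - 2 * a) powr (- 1 / 2))"
proof -
  let ?\<sigma> = "1 / sqrt (1 - 2 * a)"
  have pos: "0 < ?\<sigma>" using assms by simp
  have sq: "?\<sigma>\<^sup>2 = 1 / (1 - 2 * a)" using assms by (simp add: power_divide)
  have "exp (a * g\<^sup>2) * std_normal_density g = ?\<sigma> * normal_density 0 ?\<sigma> g" for g
  proof -
    have "a * g\<^sup>2 + - g\<^sup>2 / 2 = - (g - 0)\<^sup>2 / (2 * ?\<sigma>\<^sup>2)"
      unfolding sq using assms by (simp add: field_simps)
    from arg_cong[OF this, of exp]
    have 1: "exp (a * g\<^sup>2) * exp (- g\<^sup>2 / 2) = exp (- (g - 0)\<^sup>2 / (2 * ?\<sigma>\<^sup>2))"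
      by (simp only: exp_add)
    have 2: "1 / sqrt (2 * pi) = ?\<sigma> * (1 / sqrt (2 * pi * ?\<sigma>\<^sup>2))"
      using pos by (simp add: real_sqrt_mult real_sqrt_divide field_simps)
    have "exp (a * g\<^sup>2) * std_normal_density g = 1 / sqrt (2 * pi) * (exp (a * g\<^sup>2) * exp (- g\<^sup>2 / 2))"
      unfolding std_normal_density_def by (simp only: mult_ac)
    also have "\<dots> = ?\<sigma> * normal_density 0 ?\<sigma> g"
      unfolding 1 2 normal_density_def by (simp only: mult.assoc)
    finally show ?thesis .
  qed
  then have "ennreal (exp (a * g\<^sup>2)) * ennreal (std_normal_density g) =
      ennreal ?\<sigma> * ennreal (normal_density 0 ?\<sigma> g)" for g
    using pos by (simp flip: ennreal_mult)
  moreover have "?\<sigma> = (1 - 2 * a) powr (- 1 / 2)"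
    using assms by (simp add: powr_minus_divide powr_half_sqrt)
  ultimately show ?thesis
    using nn_integral_normal_density[OF pos, of 0] by (simp add: nn_integral_cmult)
qed

text \<open>Writing \<open>exp (s * x\<^sup>2)\<close> as the integral of \<open>exp (sqrt (2 * s) * g * x)\<close> over a standard normal \<open>g\<close>
  makes the exponent linear, so that no independence of the \<open>X i\<close> is needed.\<close>

lemma (in prob_space) mgf_sum_squares:
  assumes "finite I" "0 \<le> s" "0 \<le> v" "2 * s * v < 1"
    and "\<And>i. i \<in> I \<Longrightarrow> X i \<in> borel_measurable M"
    and "Y \<in> borel_measurable M" "0 \<le> C"
    and "\<And>c. (\<integral>\<^sup>+\<omega>. ennreal (exp (Y \<omega> + (\<Sum>i\<in>I. c i * X i \<omega>))) \<partial>M) \<le> ennreal (C * exp (v / 2 * (\<Sum>i\<in>I. (c i)\<^sup>2)))"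
  shows "(\<integral>\<^sup>+\<omega>. ennreal (exp (Y \<omega> + s * (\<Sum>i\<in>I. (X i \<omega>)\<^sup>2))) \<partial>M) \<le> ennreal (C * (1 - 2 * s * v) powr (- real (card I) / 2))"
  using assms(1,5-)
proof (induction I arbitrary: Y C rule: finite_induct)
  case empty
  from empty(4)[of "\<lambda>_. 0"] show ?case using assms(4) by simp
next
  case (insert k I)
  note [measurable] = insert.prems(1) insert.prems(2)
  let ?r = "(1 - 2 * s * v) powr (- real (card I) / 2)"
  have X [measurable]: "X k \<in> borel_measurable M" by auto
  have Xi [measurable]: "i \<in> I \<Longrightarrow> X i \<in> borel_measurable M" for i by auto
  let ?Z = "\<lambda>\<omega>. Y \<omega> + s * (\<Sum>i\<in>I. (X i \<omega>)\<^sup>2)"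
  interpret L: pair_sigma_finite M lborel ..
  \<comment> \<open>For fixed \<open>g\<close> the linear term in \<open>X k\<close> is moved into
    \<open>Y\<close>, and \<open>C\<close> takes up the factor
    \<open>exp (s * v * g\<^sup>2)\<close>; this is why the induction generalizes over
    \<open>Y\<close> and \<open>C\<close>.\<close>
  have IH: "(\<integral>\<^sup>+\<omega>. ennreal (exp (Y \<omega> + sqrt (2 * s) * g * X k \<omega> + s * (\<Sum>i\<in>I. (X i \<omega>)\<^sup>2))) \<partial>M)
      \<le> ennreal (C * exp (s * v * g\<^sup>2) * ?r)" for g
  proof (rule insert.IH)
    fix c :: "'b \<Rightarrow> real"
    \<comment> \<open>The hypothesis for \<open>insert k I\<close> is tested on the coefficients
      \<open>c\<close> extended at \<open>k\<close> by the weight of \<open>X k\<close>.\<close>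
    let ?c = "c(k := sqrt (2 * s) * g)"
    have 1: "(\<Sum>i\<in>insert k I. ?c i * X i \<omega>) = sqrt (2 * s) * g * X k \<omega> + (\<Sum>i\<in>I. c i * X i \<omega>)" for \<omega>
      using insert.hyps by (auto intro!: sum.cong)
    have "(\<Sum>i\<in>insert k I. (?c i)\<^sup>2) = (sqrt (2 * s) * g)\<^sup>2 + (\<Sum>i\<in>I. (c i)\<^sup>2)"
      using insert.hyps by (auto intro!: sum.cong)
    also have "(sqrt (2 * s) * g)\<^sup>2 = 2 * s * g\<^sup>2"
      using assms(2) by (simp add: power_mult_distrib)
    finally have 2: "exp (v / 2 * (\<Sum>i\<in>insert k I. (?c i)\<^sup>2)) = exp (s * v * g\<^sup>2) * exp (v / 2 * (\<Sum>i\<in>I. (c i)\<^sup>2))"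
      by (simp add: algebra_simps flip: exp_add)
    show "(\<integral>\<^sup>+\<omega>. ennreal (exp (Y \<omega> + sqrt (2 * s) * g * X k \<omega> + (\<Sum>i\<in>I. c i * X i \<omega>))) \<partial>M)
        \<le> ennreal (C * exp (s * v * g\<^sup>2) * exp (v / 2 * (\<Sum>i\<in>I. (c i)\<^sup>2)))"
      using insert.prems(4)[of ?c] unfolding 1 2 by (simp only: add.assoc mult.assoc)
  qed (use \<open>0 \<le> C\<close> in auto)
  have "ennreal (exp (Y \<omega> + s * (\<Sum>i\<in>insert k I. (X i \<omega>)\<^sup>2))) =
      (\<integral>\<^sup>+g. ennreal (exp (?Z \<omega> + sqrt (2 * s) * g * X k \<omega>)) * ennreal (std_normal_density g) \<partial>lborel)" for \<omega>
  proof -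
    have "(\<integral>\<^sup>+g. ennreal (exp (?Z \<omega> + sqrt (2 * s) * g * X k \<omega>)) * ennreal (std_normal_density g) \<partial>lborel)
      = (\<integral>\<^sup>+g. ennreal (exp (?Z \<omega>)) * (ennreal (exp ((sqrt (2 * s) * X k \<omega>) * g)) * ennreal (std_normal_density g)) \<partial>lborel)"
      by (intro nn_integral_cong) (simp add: exp_add ennreal_mult mult_ac)
    also have "\<dots> = ennreal (exp (?Z \<omega>)) * ennreal (exp ((sqrt (2 * s) * X k \<omega>)\<^sup>2 / 2))"
      by (subst nn_integral_cmult) (auto simp: nn_integral_exp_normal)
    also have "\<dots> = ennreal (exp (?Z \<omega> + s * (X k \<omega>)\<^sup>2))"
      using assms(2) by (simp add: exp_add power_mult_distrib flip: ennreal_mult)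
    finally show ?thesis using insert.hyps by (simp add: algebra_simps)
  qed
  then have "(\<integral>\<^sup>+\<omega>. ennreal (exp (Y \<omega> + s * (\<Sum>i\<in>insert k I. (X i \<omega>)\<^sup>2))) \<partial>M) =
      (\<integral>\<^sup>+\<omega>. \<integral>\<^sup>+g. ennreal (exp (?Z \<omega> + sqrt (2 * s) * g * X k \<omega>)) * ennreal (std_normal_density g) \<partial>lborel \<partial>M)"
    by simp
  also have "\<dots> = (\<integral>\<^sup>+g. \<integral>\<^sup>+\<omega>. ennreal (exp (?Z \<omega> + sqrt (2 * s) * g * X k \<omega>)) * ennreal (std_normal_density g) \<partial>M \<partial>lborel)"
    by (rule L.Fubini'[symmetric]) measurable
  also have "\<dots> \<le> (\<integral>\<^sup>+g. ennreal (C * ?r) * (ennreal (exp (s * v * g\<^sup>2)) * ennreal (std_normal_density g)) \<partial>lborel)"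
  proof (rule nn_integral_mono)
    fix g :: real
    have "(\<integral>\<^sup>+\<omega>. ennreal (exp (?Z \<omega> + sqrt (2 * s) * g * X k \<omega>)) * ennreal (std_normal_density g) \<partial>M) =
      (\<integral>\<^sup>+\<omega>. ennreal (exp (?Z \<omega> + sqrt (2 * s) * g * X k \<omega>)) \<partial>M) * ennreal (std_normal_density g)"
      by (rule nn_integral_multc) measurable
    also have "\<dots> \<le> ennreal (C * exp (s * v * g\<^sup>2) * ?r) * ennreal (std_normal_density g)"
      using IH[of g] by (intro mult_right_mono) (simp_all add: ac_simps)
    also have "\<dots> = ennreal (C * ?r) * (ennreal (exp (s * v * g\<^sup>2)) * ennreal (std_normal_density g))"
      using \<open>0 \<le> C\<close> by (simp add: mult_ac flip: ennreal_mult)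
    finally show "(\<integral>\<^sup>+\<omega>. ennreal (exp (?Z \<omega> + sqrt (2 * s) * g * X k \<omega>)) * ennreal (std_normal_density g) \<partial>M)
      \<le> ennreal (C * ?r) * (ennreal (exp (s * v * g\<^sup>2)) * ennreal (std_normal_density g))" .
  qed
  \<comment> \<open>The remaining integral over \<open>g\<close> contributes the factor for the new
    index \<open>k\<close>.\<close>
  also have "\<dots> = ennreal (C * ?r) * ennreal ((1 - 2 * (s * v)) powr (- 1 / 2))"
    using assms(4) by (subst nn_integral_cmult) (auto simp: nn_integral_exp_square_std_normal)
  also have "\<dots> = ennreal (C * (?r * (1 - 2 * s * v) powr (- 1 / 2)))"
    using \<open>0 \<le> C\<close> by (simp add: mult_ac flip: ennreal_mult)
  also have "?r * (1 - 2 * s * v) powr (- 1 / 2) = (1 - 2 * s * v) powr (- real (card (insert k I)) / 2)"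
    using insert.hyps by (simp add: field_simps flip: powr_add)
  finally show ?case .
qed

subsection \<open>Orthonormal systems in coordinate space\<close>

text \<open>This form serves both for vectors of grid values and for vectors of basis coefficients,
  each indexed by \<open>{1..p}\<close>.\<close>

definition ip :: "'i set \<Rightarrow> ('i \<Rightarrow> real) \<Rightarrow> ('i \<Rightarrow> real) \<Rightarrow> real" where
  "ip A x y = (\<Sum>a\<in>A. x a * y a)"

lemma ip_commute: "ip A x y = ip A y x"
  by (simp add: ip_def mult.commute)

lemma ip_add_left: "ip A (\<lambda>a. x a + y a) z = ip A x z + ip A y z"
  by (simp add: ip_def sum.distrib distrib_right)

lemma ip_add_right: "ip A z (\<lambda>a. x a + y a) = ip A z x + ip A z y"
  by (simp add: ip_def sum.distrib distrib_left)

lemma ip_diff_left: "ip A (\<lambda>a. x a - y a) z = ip A x z - ip A y z"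
  by (simp add: ip_def sum_subtractf left_diff_distrib)

lemma ip_diff_right: "ip A z (\<lambda>a. x a - y a) = ip A z x - ip A z y"
  by (simp add: ip_def sum_subtractf right_diff_distrib)

lemma ip_scale_left: "ip A (\<lambda>a. c * x a) z = c * ip A x z"
  by (simp add: ip_def sum_distrib_left mult.assoc)

lemma ip_scale_right: "ip A z (\<lambda>a. c * x a) = c * ip A z x"
  by (simp add: ip_def sum_distrib_left mult_ac)

lemma ip_sum_left: "ip A (\<lambda>a. \<Sum>i\<in>J. x i a) z = (\<Sum>i\<in>J. ip A (x i) z)"
  unfolding ip_def sum_distrib_right by (rule sum.swap)

lemma ip_cong: "(\<And>a. a \<in> A \<Longrightarrow> x a = x' a) \<Longrightarrow> (\<And>a. a \<in> A \<Longrightarrow> y a = y' a) \<Longrightarrow> ip A x y = ip A x' y'"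
  by (auto simp: ip_def intro!: sum.cong)

lemma ip_self_nonneg: "0 \<le> ip A x x"
  by (simp add: ip_def sum_nonneg)

lemma ip_self_eq_0: "finite A \<Longrightarrow> ip A x x = 0 \<Longrightarrow> a \<in> A \<Longrightarrow> x a = 0"
  by (simp add: ip_def sum_nonneg_eq_0_iff)

text \<open>Since \<open>x / 0 = 0\<close>, a vector that vanishes on \<open>A\<close> is normalized to one that vanishes everywhere.\<close>

definition normalized :: "'i set \<Rightarrow> ('i \<Rightarrow> real) \<Rightarrow> 'i \<Rightarrow> real" where
  "normalized A r = (\<lambda>a. 1 / sqrt (ip A r r) * r a)"

lemma normalized_unit: "ip A (normalized A r) (normalized A r) = 1 \<or> (\<forall>a\<in>A. normalized A r a = 0)"
proof (cases "ip A r r = 0")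
  case True
  then show ?thesis by (simp add: normalized_def)
next
  case False
  then have "ip A r r > 0" using ip_self_nonneg[of A r] by linarith
  then show ?thesis unfolding normalized_def ip_scale_left ip_scale_right by (simp add: field_simps)
qed

lemma normalized_expand:
  assumes "finite A" "a \<in> A"
  shows "r a = ip A r (normalized A r) * normalized A r a"
proof (cases "ip A r r = 0")
  case True
  then show ?thesis using ip_self_eq_0[OF assms(1) True assms(2)] by (simp add: normalized_def)
next
  case False
  then have "ip A r r > 0" using ip_self_nonneg[of A r] by linarith
  then show ?thesis unfolding normalized_def ip_scale_right by (simp add: field_simps)
qed

lemma ip_normalized_le_1: "ip A (normalized A r) (normalized A r) \<le> 1"
  using normalized_unit[of A r] by (elim disjE) (simp_all add: ip_def)

text \<open>Linearly dependent inputs produce zero vectors, so that the index set does not change.\<close>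

definition is_frame :: "'i set \<Rightarrow> 'k \<Rightarrow> 'k set \<Rightarrow> ('k \<Rightarrow> 'i \<Rightarrow> real) \<Rightarrow> ('k \<Rightarrow> 'i \<Rightarrow> real) \<Rightarrow> bool" where
  "is_frame A k I f e \<longleftrightarrow> e k = normalized A (f k) \<and>
     (\<forall>i\<in>insert k I. \<forall>j\<in>insert k I. i \<noteq> j \<longrightarrow> ip A (e i) (e j) = 0) \<and>
     (\<forall>i\<in>insert k I. ip A (e i) (e i) = 1 \<or> (\<forall>a\<in>A. e i a = 0)) \<and>
     (\<forall>i\<in>I. \<forall>a\<in>A. f i a = (\<Sum>j\<in>insert k I. ip A (f i) (e j) * e j a))"

lemma is_frameD:
  assumes "is_frame A k I f e"
  shows "\<And>i j. i \<in> insert k I \<Longrightarrow> j \<in> insert k I \<Longrightarrow> i \<noteq> j \<Longrightarrow> ip A (e i) (e j) = 0"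
    and "\<And>i. i \<in> insert k I \<Longrightarrow> ip A (e i) (e i) = 1 \<or> (\<forall>a\<in>A. e i a = 0)"
    and "e k = normalized A (f k)"
    and "\<And>i a. i \<in> I \<Longrightarrow> a \<in> A \<Longrightarrow> f i a = (\<Sum>j\<in>insert k I. ip A (f i) (e j) * e j a)"
  using assms unfolding is_frame_def by blast+

text \<open>Orthogonalization in which \<open>k\<close> is processed first, so that
  \<open>e k\<close> keeps the direction of \<open>f k\<close>. The induction appends one vector of
  \<open>I\<close> at a time.\<close>

lemma gram_schmidt:
  fixes f :: "'k \<Rightarrow> 'i \<Rightarrow> real"
  assumes "finite A" "finite I" "k \<notin> I"
  shows "\<exists>e. is_frame A k I f e"
  using assms(2,3)
proof (induction I rule: finite_induct)
  case empty
  show ?case unfolding is_frame_def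
    by (intro exI[of _ "\<lambda>_. normalized A (f k)"]) (use normalized_unit in simp)
next
  case (insert x I)
  let ?J = "insert k I"
  have fin: "finite ?J" and xJ: "x \<notin> ?J" using insert by auto
  from insert obtain e where "is_frame A k I f e" by auto
  note orth = is_frameD(1)[OF this] and unit = is_frameD(2)[OF this]
    and ek = is_frameD(3)[OF this] and fi = is_frameD(4)[OF this]
  \<comment> \<open>The residual of the new vector after projection on the frame built so
    far.\<close>
  define r where "r = (\<lambda>a. f x a - (\<Sum>j\<in>?J. ip A (f x) (e j) * e j a))"
  have r_orth: "ip A r (e j) = 0" if j: "j \<in> ?J" for j
  proof -
    have "ip A r (e j) = ip A (f x) (e j) - (\<Sum>i\<in>?J. ip A (f x) (e i) * ip A (e i) (e j))"
      unfolding r_def ip_diff_left ip_sum_left ip_scale_left ..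
    also have "(\<Sum>i\<in>?J. ip A (f x) (e i) * ip A (e i) (e j)) = (\<Sum>i\<in>?J. if i = j then ip A (f x) (e j) * ip A (e j) (e j) else 0)"
      using orth j by (intro sum.cong) auto
    also have "\<dots> = ip A (f x) (e j) * ip A (e j) (e j)" using fin j by simp
    \<comment> \<open>If \<open>e j\<close> vanishes on \<open>A\<close>, the coefficient along it
      is itself 0, so the equation also holds for zero frame vectors.\<close>
    also have "\<dots> = ip A (f x) (e j)" using unit[OF j] by (auto simp: ip_def)
    finally show ?thesis by simp
  qed
  define w where "w = normalized A r"
  have w_unit: "ip A w w = 1 \<or> (\<forall>a\<in>A. w a = 0)" unfolding w_def by (rule normalized_unit)
  have w_orth: "ip A (e j) w = 0" if "j \<in> ?J" for j
    unfolding w_def normalized_def ip_scale_right ip_commute[of A "e j"] using r_orth[OF that] by simp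
  then have w_orth': "ip A w (e j) = 0" if "j \<in> ?J" for j
    using that by (subst ip_commute) blast
  \<comment> \<open>The earlier vectors lie in the span of the old frame, so they have no component
    along \<open>w\<close> and their expansions are unchanged by the extension.\<close>
  have fiw: "ip A (f i) w = 0" if "i \<in> I" for i
  proof -
    have "ip A (f i) w = ip A (\<lambda>a. \<Sum>j\<in>?J. ip A (f i) (e j) * e j a) w"
      using fi[OF that] by (intro ip_cong) auto
    also have "\<dots> = 0" unfolding ip_sum_left ip_scale_left using w_orth by simp
    finally show ?thesis .
  qed
  have "ip A (f x) w = ip A (\<lambda>a. r a + (\<Sum>j\<in>?J. ip A (f x) (e j) * e j a)) w"
    by (simp add: r_def)
  also have "\<dots> = ip A r w" unfolding ip_add_left ip_sum_left ip_scale_left using w_orth by simp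
  finally have fxw: "ip A (f x) w = ip A r w" .
  let ?e = "e(x := w)"
  have sum_e: "(\<Sum>j\<in>insert k (insert x I). ip A g (?e j) * ?e j a) = ip A g w * w a + (\<Sum>j\<in>?J. ip A g (e j) * e j a)" for g a
  proof -
    have "insert k (insert x I) = insert x ?J" by auto
    moreover have "(\<Sum>j\<in>?J. ip A g (?e j) * ?e j a) = (\<Sum>j\<in>?J. ip A g (e j) * e j a)"
      using xJ by (intro sum.cong) auto
    ultimately show ?thesis using fin xJ by (simp del: sum.insert add: sum.insert[OF fin xJ])
  qed
  have kx: "k \<noteq> x" using insert by auto
  show ?case unfolding is_frame_def
  proof (intro exI[of _ ?e] conjI ballI impI)
    fix i j assume "i \<in> insert k (insert x I)" "j \<in> insert k (insert x I)" "i \<noteq> j"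
    then show "ip A (?e i) (?e j) = 0"
      using orth w_orth w_orth' by auto
  next
    fix i assume "i \<in> insert k (insert x I)"
    then show "ip A (?e i) (?e i) = 1 \<or> (\<forall>a\<in>A. ?e i a = 0)"
      using unit w_unit by auto
  next
    show "?e k = normalized A (f k)" using ek kx by simp
  next
    fix i a assume i: "i \<in> insert x I" and a: "a \<in> A"
    show "f i a = (\<Sum>j\<in>insert k (insert x I). ip A (f i) (?e j) * ?e j a)"
    proof (cases "i = x")
      case True
      have "f x a = r a + (\<Sum>j\<in>?J. ip A (f x) (e j) * e j a)" by (simp add: r_def)
      also have "r a = ip A (f x) w * w a" unfolding fxw unfolding w_def using assms(1) a by (rule normalized_expand)
      finally show ?thesis unfolding True sum_e .
    next
      case False
      with i have i: "i \<in> I" by simp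
      show ?thesis unfolding sum_e fiw[OF i] using fi[OF i a] by simp
    qed
  qed
qed

text \<open>Orthogonalizing \<open>h\<close> first and the unit vectors of \<open>I\<close>
  afterwards makes every \<open>e i\<close> with \<open>i\<close> in \<open>I\<close> orthogonal to
  \<open>h\<close>, while vectors supported on \<open>I\<close> remain in the span. The first
  property is an inequality because some frame vectors may be zero.\<close>

lemma adapted_frame:
  fixes h :: "'i \<Rightarrow> real"
  assumes A: "finite A" and I: "I \<subseteq> A" and k: "k \<notin> I"
  obtains e :: "'i \<Rightarrow> 'i \<Rightarrow> real" where
    "\<And>c J. J \<subseteq> insert k I \<Longrightarrow> ip A (\<lambda>a. \<Sum>i\<in>J. c i * e i a) (\<lambda>a. \<Sum>i\<in>J. c i * e i a) \<le> (\<Sum>i\<in>J. (c i)\<^sup>2)"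
    "\<And>u y. (\<And>a. a \<in> A - I \<Longrightarrow> u a = 0) \<Longrightarrow> ip A u y = (\<Sum>i\<in>insert k I. ip A u (e i) * ip A (e i) y)"
    "\<And>i. i \<in> I \<Longrightarrow> ip A (e i) h = 0"
    "(ip A (e k) h)\<^sup>2 = ip A h h"
    "e k = normalized A h"
proof -
  have finI: "finite I" using A I finite_subset by blast
  \<comment> \<open>The fresh index \<open>k\<close> is only a label for \<open>h\<close>; every
    other index stands for its unit vector.\<close>
  let ?f = "\<lambda>i a. if i = k then h a else if a = i then 1 else (0::real)"
  let ?J = "insert k I"
  obtain e where "is_frame A k I ?f e" using gram_schmidt[OF A finI k] by blast
  note orth = is_frameD(1)[OF this] and unit = is_frameD(2)[OF this]
    and ek = is_frameD(3)[OF this, simplified] and fi = is_frameD(4)[OF this]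
  have fk: "h a = ip A h (e k) * e k a" if "a \<in> A" for a
    unfolding ek using A that by (rule normalized_expand)
  have delta: "ip A (?f i) y = y i" if "i \<in> I" for i and y
  proof -
    have "ip A (?f i) y = (\<Sum>a\<in>A. if a = i then y a else 0)"
      unfolding ip_def using that k by (intro sum.cong) auto
    then show ?thesis using A I that by auto
  qed
  show thesis
  proof (rule that[of e])
    fix c J assume J: "J \<subseteq> ?J"
    then have finJ: "finite J" using finI finite_subset by auto
    have "ip A (\<lambda>a. \<Sum>i\<in>J. c i * e i a) (\<lambda>a. \<Sum>i\<in>J. c i * e i a) =
        (\<Sum>i\<in>J. c i * (\<Sum>j\<in>J. c j * ip A (e j) (e i)))"
      unfolding ip_sum_left ip_scale_left
      by (subst ip_commute) (simp add: ip_sum_left ip_scale_left)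
    also have "\<dots> = (\<Sum>i\<in>J. c i * (\<Sum>j\<in>J. if j = i then c i * ip A (e i) (e i) else 0))"
      using J orth by (intro sum.cong arg_cong2[where f = "(*)"] refl) (auto simp: subset_iff)
    also have "\<dots> = (\<Sum>i\<in>J. (c i)\<^sup>2 * ip A (e i) (e i))"
      using finJ by (simp add: power2_eq_square mult.assoc)
    also have "\<dots> \<le> (\<Sum>i\<in>J. (c i)\<^sup>2 * 1)"
    proof (intro sum_mono mult_left_mono)
      fix i assume "i \<in> J"
      then have "ip A (e i) (e i) = 1 \<or> (\<forall>a\<in>A. e i a = 0)" using unit J by blast
      then show "ip A (e i) (e i) \<le> 1" by (elim disjE) (simp_all add: ip_def)
    qed auto
    finally show "ip A (\<lambda>a. \<Sum>i\<in>J. c i * e i a) (\<lambda>a. \<Sum>i\<in>J. c i * e i a) \<le> (\<Sum>i\<in>J. (c i)\<^sup>2)" by simp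
  next
    fix u y :: "'i \<Rightarrow> real" assume u: "\<And>a. a \<in> A - I \<Longrightarrow> u a = 0"
    have u_ip: "ip A u g = (\<Sum>i\<in>I. u i * g i)" for g
      unfolding ip_def using A I u by (intro sum.mono_neutral_right) auto
    \<comment> \<open>The coordinate \<open>y i\<close> is the inner product of \<open>y\<close>
      with a unit vector, whose frame expansion is inserted; the coefficient of that expansion along
      \<open>e j\<close> is \<open>e j i\<close>.\<close>
    have "y i = (\<Sum>j\<in>?J. e j i * ip A (e j) y)" if "i \<in> I" for i
    proof -
      have "y i = ip A (?f i) y" using delta[OF that] by simp
      also have "\<dots> = ip A (\<lambda>a. \<Sum>j\<in>?J. ip A (?f i) (e j) * e j a) y"
        using fi[OF that] by (intro ip_cong) auto
      also have "\<dots> = (\<Sum>j\<in>?J. ip A (?f i) (e j) * ip A (e j) y)"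
        by (simp only: ip_sum_left ip_scale_left)
      finally show ?thesis by (simp only: delta[OF that])
    qed
    then have "ip A u y = (\<Sum>i\<in>I. u i * (\<Sum>j\<in>?J. e j i * ip A (e j) y))"
      unfolding u_ip by (intro sum.cong) auto
    also have "\<dots> = (\<Sum>j\<in>?J. \<Sum>i\<in>I. u i * e j i * ip A (e j) y)"
      unfolding sum_distrib_left mult.assoc by (rule sum.swap)
    also have "\<dots> = (\<Sum>j\<in>?J. ip A u (e j) * ip A (e j) y)"
      unfolding u_ip sum_distrib_right ..
    finally show "ip A u y = (\<Sum>i\<in>?J. ip A u (e i) * ip A (e i) y)" .
  next
    fix i assume i: "i \<in> I"
    have "ip A (e i) h = ip A (e i) (\<lambda>a. ip A h (e k) * e k a)"
      using fk by (intro ip_cong) auto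
    then show "ip A (e i) h = 0" using orth[of i k] i k by (auto simp: ip_scale_right)
  next
    have "ip A h h = ip A (\<lambda>a. ip A h (e k) * e k a) h"
      using fk by (intro ip_cong) auto
    then show "(ip A (e k) h)\<^sup>2 = ip A h h"
      by (simp add: ip_scale_left ip_commute power2_eq_square)
  qed (fact ek)
qed

text \<open>Write \<open>a\<close> and \<open>b\<close> for the squared errors of \<open>x\<close>
  and \<open>w\<close>, and \<open>u = x - w\<close>. Twice the contrast inequality, combined with
  \<open>5 / 6 * |u|\<^sup>2 \<le> a + 5 * b\<close>, gives
  \<open>a \<le> 7 * b - 5 / 6 * |u|\<^sup>2\<close> plus cross terms and penalties. The negative
  square then absorbs the cross terms one frame coordinate at a time.\<close>

lemma contrast_comparison:
  fixes S h \<nu> x w :: "'i \<Rightarrow> real"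
  assumes A: "finite A" and I: "finite I" "k \<notin> I"
    and supp: "\<And>y. ip A (\<lambda>a. x a - w a) y = (\<Sum>i\<in>insert k I. ip A (\<lambda>a. x a - w a) (e i) * ip A (e i) y)"
    and h: "\<And>i. i \<in> I \<Longrightarrow> ip A (e i) h = 0" "(ip A (e k) h)\<^sup>2 = ip A h h"
    and le: "ip A x x - 2 * ip A x (\<lambda>a. S a + h a + \<nu> a) + P' \<le> ip A w w - 2 * ip A w (\<lambda>a. S a + h a + \<nu> a) + P"
  shows "ip A (\<lambda>a. x a - S a) (\<lambda>a. x a - S a) \<le> 7 * ip A (\<lambda>a. w a - S a) (\<lambda>a. w a - S a) + 8 * ip A h h
    + 12 * (ip A (e k) \<nu>)\<^sup>2 + 8 * (\<Sum>i\<in>I. (ip A (e i) \<nu>)\<^sup>2) + 2 * P - 2 * P'"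
proof -
  let ?a = "ip A (\<lambda>a. x a - S a) (\<lambda>a. x a - S a)" and ?b = "ip A (\<lambda>a. w a - S a) (\<lambda>a. w a - S a)"
  let ?u = "\<lambda>a. x a - w a"
  define \<theta> where "\<theta> i = ip A ?u (e i)" for i
  define G where "G i = ip A (e i) \<nu>" for i
  have uu: "ip A ?u ?u = (\<theta> k)\<^sup>2 + (\<Sum>i\<in>I. (\<theta> i)\<^sup>2)"
    using supp[of ?u] I unfolding ip_commute[of A "e _"] by (simp add: \<theta>_def power2_eq_square)
  have u\<nu>: "ip A ?u \<nu> = \<theta> k * G k + (\<Sum>i\<in>I. \<theta> i * G i)"
    using supp[of \<nu>] I by (simp add: \<theta>_def G_def)
  have uh: "ip A ?u h = \<theta> k * ip A (e k) h"
    using supp[of h] I h(1) by (simp add: \<theta>_def)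
  \<comment> \<open>The weight 5 is what turns the factor 2 of \<open>b\<close> into 7: expanding
    this square yields \<open>5 * |u|\<^sup>2 \<le> 6 * a + 30 * b\<close>.\<close>
  have "ip A (\<lambda>a. (x a - S a) + 5 * (w a - S a)) (\<lambda>a. (x a - S a) + 5 * (w a - S a)) \<ge> 0"
    by (rule ip_self_nonneg)
  then have "6 * ?a + 30 * ?b \<ge> 5 * ip A ?u ?u"
    unfolding ip_add_left ip_add_right ip_scale_left ip_scale_right ip_diff_left ip_diff_right
    by (simp add: ip_commute algebra_simps)
  moreover have "?a - ?b - 2 * ip A ?u h - 2 * ip A ?u \<nu> \<le> P - P'"
    using le unfolding ip_add_right ip_diff_left ip_diff_right
    by (simp add: ip_commute algebra_simps)
  ultimately have "?a \<le> 7 * ?b - 5 / 6 * ip A ?u ?u + 4 * ip A ?u h + 4 * ip A ?u \<nu> + 2 * P - 2 * P'"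
    by linarith
  \<comment> \<open>Along \<open>e k\<close> the available \<open>5 / 6\<close> is split as
    \<open>1 / 2 + 1 / 3\<close>: the first share pays for \<open>h\<close> with constant 8, the
    second for the noise with constant 12. In the other coordinates \<open>h\<close> is absent, so
    \<open>1 / 2\<close> suffices for noise constant 8.\<close>
  moreover have "4 * ip A ?u h \<le> (\<theta> k)\<^sup>2 / 2 + 8 * ip A h h"
    using zero_le_power2[of "\<theta> k / 2 - 2 * ip A (e k) h"] unfolding uh
    by (simp add: power2_eq_square algebra_simps flip: h(2))
  moreover have "4 * (\<theta> k * G k) \<le> (\<theta> k)\<^sup>2 / 3 + 12 * (G k)\<^sup>2"
    using zero_le_power2[of "\<theta> k - 6 * G k"] by (simp add: power2_eq_square algebra_simps)
  moreover have "4 * (\<Sum>i\<in>I. \<theta> i * G i) \<le> 5 / 6 * (\<Sum>i\<in>I. (\<theta> i)\<^sup>2) + 8 * (\<Sum>i\<in>I. (G i)\<^sup>2)"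
    unfolding sum_distrib_left sum.distrib[symmetric]
  proof (rule sum_mono)
    fix i
    have "4 * (\<theta> i * G i) \<le> (\<theta> i)\<^sup>2 / 2 + 8 * (G i)\<^sup>2"
      using zero_le_power2[of "\<theta> i - 4 * G i"] by (simp add: power2_eq_square algebra_simps)
    then show "4 * (\<theta> i * G i) \<le> 5 / 6 * (\<theta> i)\<^sup>2 + 8 * (G i)\<^sup>2"
      using zero_le_power2[of "\<theta> i"] by linarith
  qed
  ultimately show ?thesis unfolding uu u\<nu> G_def[symmetric] by (simp add: algebra_simps)
qed

subsection \<open>The Rayleigh quotient of a symmetric matrix\<close>

text \<open>The first-order condition at a maximum. The test value \<open>t = \<beta> / g\<close>
  with \<open>g > \<bar>\<gamma>\<bar>\<close> lets the linear term dominate the quadratic one,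
  which contradicts the sign unless \<open>\<beta> = 0\<close>.\<close>

lemma linear_coeff_zero:
  fixes \<beta> \<gamma> :: real
  assumes "\<And>t. 2 * t * \<beta> + t\<^sup>2 * \<gamma> \<le> 0"
  shows "\<beta> = 0"
proof (rule ccontr)
  assume "\<beta> \<noteq> 0"
  define g where "g = \<bar>\<gamma>\<bar> + 1"
  have g: "0 < g" "0 < 2 * g + \<gamma>" by (auto simp: g_def)
  have "g\<^sup>2 * (2 * (\<beta> / g) * \<beta> + (\<beta> / g)\<^sup>2 * \<gamma>) = \<beta>\<^sup>2 * (2 * g + \<gamma>)"
    using g by (simp add: power2_eq_square field_simps)
  moreover have "g\<^sup>2 * (2 * (\<beta> / g) * \<beta> + (\<beta> / g)\<^sup>2 * \<gamma>) \<le> 0"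
    using assms[of "\<beta> / g"] by (intro mult_nonneg_nonpos) auto
  moreover have "0 < \<beta>\<^sup>2 * (2 * g + \<gamma>)" using \<open>\<beta> \<noteq> 0\<close> g by (intro mult_pos_pos) auto
  ultimately show False by linarith
qed

text \<open>The unit sphere of dimension \<open>p\<close> is represented by sequences that vanish
  from index \<open>p\<close> on. In the product topology it is a closed subset of a product of
  intervals \<open>[-1, 1]\<close>, which is compact by Tychonoff.\<close>

lemma compact_coordinate_sphere:
  "compact {c :: nat \<Rightarrow> real. (\<forall>i\<ge>p. c i = 0) \<and> (\<Sum>i<p. (c i)\<^sup>2) = 1}" (is "compact ?K")
proof -
  have box: "compact (Pi\<^sub>E UNIV (\<lambda>_::nat. {-1..1::real}))"
    unfolding compactin_euclidean_iff[symmetric] euclidean_product_topology[symmetric] compactin_PiE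
    by (simp add: compactin_euclidean_iff)
  have "?K \<subseteq> Pi\<^sub>E UNIV (\<lambda>_::nat. {-1..1::real})"
  proof (clarsimp simp: PiE_UNIV_domain)
    fix c :: "nat \<Rightarrow> real" and i assume c: "\<forall>i\<ge>p. c i = 0" "(\<Sum>i<p. (c i)\<^sup>2) = 1"
    have "(c i)\<^sup>2 \<le> 1"
    proof (cases "i < p")
      case True
      then show ?thesis using c(2) member_le_sum[of i "{..<p}" "\<lambda>i. (c i)\<^sup>2"] by simp
    qed (use c in auto)
    then show "- 1 \<le> c i \<and> c i \<le> 1" by (simp add: abs_square_le_1 abs_le_iff)
  qed
  moreover have "closed ?K"
    by (intro closed_Collect_conj closed_Collect_all closed_Collect_imp closed_Collect_eq open_Collect_const continuous_intros) simp_all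
  ultimately show ?thesis using box compact_Int_closed[OF box, of ?K] by (simp add: Int_absorb1)
qed

text \<open>The form attains its maximum on the sphere at some \<open>c0\<close>. By homogeneity
  \<open>q c \<le> q c0 * N c\<close> everywhere, and the first-order condition for this inequality
  at \<open>c0\<close> says that \<open>c0\<close> is an eigenvector with eigenvalue
  \<open>q c0\<close>, hence \<open>q c0 \<le> lambda_max B\<close>.\<close>

lemma quadratic_form_le_lambda_max:
  fixes B :: "real mat"
  assumes B: "B \<in> carrier_mat p p" and p: "0 < p"
    and sym: "\<And>i j. i < p \<Longrightarrow> j < p \<Longrightarrow> B $$ (i, j) = B $$ (j, i)"
  shows "(\<Sum>i<p. \<Sum>j<p. c i * B $$ (i, j) * c j) \<le> lambda_max B * (\<Sum>i<p. (c i)\<^sup>2)"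
proof -
  define q where "q c = (\<Sum>i<p. \<Sum>j<p. c i * B $$ (i, j) * c j)" for c :: "nat \<Rightarrow> real"
  define N where "N c = (\<Sum>i<p. (c i)\<^sup>2)" for c :: "nat \<Rightarrow> real"
  let ?K = "{c :: nat \<Rightarrow> real. (\<forall>i\<ge>p. c i = 0) \<and> (\<Sum>i<p. (c i)\<^sup>2) = 1}"
  have "(\<Sum>i<p. (if i = 0 then 1 else 0 :: real)\<^sup>2) = (\<Sum>i<p. if i = 0 then 1 else 0)"
    by (intro sum.cong) auto
  also have "\<dots> = 1" using p by simp
  finally have "(\<lambda>i. if i = 0 then 1 else 0) \<in> ?K" using p by simp
  then have "?K \<noteq> {}" by (rule ex_in_conv[THEN iffD1, OF exI])
  moreover have "continuous_on ?K q" unfolding q_def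
    by (intro continuous_intros continuous_on_subset[OF continuous_on_product_coordinates]) simp_all
  ultimately have "\<exists>c0\<in>?K. \<forall>c\<in>?K. q c \<le> q c0"
    by (intro continuous_attains_sup compact_coordinate_sphere)
  then obtain c0 where c0: "c0 \<in> ?K" and mx: "\<forall>c\<in>?K. q c \<le> q c0" by (rule bexE)
  have c0_max: "q c \<le> q c0" if "c \<in> ?K" for c using mx that by (rule bspec)
  have le: "q c \<le> q c0 * N c" for c
  proof (cases "N c = 0")
    case True
    then have "\<And>i. i < p \<Longrightarrow> c i = 0" unfolding N_def by (subst (asm) sum_nonneg_eq_0_iff) auto
    then have "q c = 0" unfolding q_def by (intro sum.neutral) auto
    with True show ?thesis by simp
  next
    case False
    then have pos: "0 < N c" unfolding N_def by (simp add: sum_nonneg less_le)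
    let ?c = "\<lambda>i. if i < p then c i / sqrt (N c) else 0"
    have "(\<Sum>i<p. (?c i)\<^sup>2) = N c / N c"
      using pos by (simp add: power_divide flip: sum_divide_distrib) (simp add: N_def)
    then have "?c \<in> ?K" using pos by simp
    then have "q ?c \<le> q c0" by (rule c0_max)
    moreover have "q ?c = q c / N c"
      using pos unfolding q_def sum_divide_distrib by (intro sum.cong) (auto simp: field_simps)
    ultimately show ?thesis using pos by (simp add: field_simps)
  qed
  have Nc0: "N c0 = 1" using c0 by (simp add: N_def)
  have eig: "(\<Sum>j<p. B $$ (i, j) * c0 j) = q c0 * c0 i" if i: "i < p" for i
  proof -
    have "(\<Sum>j<p. B $$ (i, j) * c0 j) - q c0 * c0 i = 0"
    proof (rule linear_coeff_zero)
      fix t :: real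
      \<comment> \<open>Only coordinate \<open>i\<close> is perturbed, by \<open>t\<close>. The
        global inequality at the perturbed point becomes a quadratic polynomial in \<open>t\<close>
        whose linear coefficient is the \<open>i\<close>th component of the eigenvalue
        equation.\<close>
      let ?d = "\<lambda>k. if k = i then t else 0"
      let ?c = "\<lambda>k. c0 k + ?d k"
      have delta: "(\<Sum>k<p. ?d k * f k) = t * f i" for f
      proof -
        have "(\<Sum>k<p. ?d k * f k) = (\<Sum>k<p. if k = i then t * f k else 0)" by (intro sum.cong) auto
        then show ?thesis using i by simp
      qed
      have "q ?c = q c0 + (\<Sum>k<p. ?d k * (\<Sum>j<p. B $$ (k, j) * c0 j)) +
          (\<Sum>k<p. c0 k * (\<Sum>j<p. ?d j * B $$ (k, j))) + (\<Sum>k<p. ?d k * (\<Sum>j<p. ?d j * B $$ (k, j)))"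
        unfolding q_def sum_distrib_left sum.distrib[symmetric]
        by (intro sum.cong refl) (simp add: algebra_simps)
      also have "\<dots> = q c0 + t * (\<Sum>j<p. B $$ (i, j) * c0 j) + (\<Sum>k<p. c0 k * (t * B $$ (k, i))) + t * (t * B $$ (i, i))"
        unfolding delta ..
      also have "(\<Sum>k<p. c0 k * (t * B $$ (k, i))) = t * (\<Sum>j<p. B $$ (i, j) * c0 j)"
        unfolding sum_distrib_left using sym i by (intro sum.cong) auto
      finally have qc: "q ?c = q c0 + 2 * t * (\<Sum>j<p. B $$ (i, j) * c0 j) + t\<^sup>2 * B $$ (i, i)"
        by (simp add: power2_eq_square algebra_simps)
      have "N ?c = N c0 + 2 * (\<Sum>k<p. ?d k * c0 k) + (\<Sum>k<p. ?d k * ?d k)"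
        unfolding N_def sum_distrib_left sum.distrib[symmetric]
        by (intro sum.cong refl) (simp add: power2_eq_square algebra_simps)
      also have "\<dots> = 1 + 2 * t * c0 i + t\<^sup>2"
        unfolding delta Nc0 by (simp add: power2_eq_square)
      finally have "q ?c \<le> q c0 * (1 + 2 * t * c0 i + t\<^sup>2)" using le[of ?c] by simp
      then show "2 * t * ((\<Sum>j<p. B $$ (i, j) * c0 j) - q c0 * c0 i) + t\<^sup>2 * (B $$ (i, i) - q c0) \<le> 0"
        unfolding qc by (simp add: algebra_simps)
    qed
    then show ?thesis by simp
  qed
  have "eigenvector B (Matrix.vec p c0) (q c0)"
    unfolding eigenvector_def
  proof (intro conjI)
    show "Matrix.vec p c0 \<in> carrier_vec (dim_row B)" using B by auto
    show "Matrix.vec p c0 \<noteq> 0\<^sub>v (dim_row B)"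
    proof
      assume "Matrix.vec p c0 = 0\<^sub>v (dim_row B)"
      then have "\<And>i. i < p \<Longrightarrow> c0 i = 0" using B by (metis carrier_matD(1) index_vec index_zero_vec(1))
      then have "N c0 = 0" by (simp add: N_def)
      with Nc0 show False by simp
    qed
    show "B *\<^sub>v Matrix.vec p c0 = q c0 \<cdot>\<^sub>v Matrix.vec p c0"
      using B eig by (intro eq_vecI) (auto simp: scalar_prod_def lessThan_atLeast0)
  qed
  then have "q c0 \<in> {k. eigenvalue B k}" by (auto simp: eigenvalue_def)
  \<comment> \<open>\<open>Max\<close> is an upper bound only on a finite set; the eigenvalues are
    the roots of the nonzero characteristic polynomial.\<close>
  moreover have "finite {k. eigenvalue B k}"
  proof -
    have "char_poly B \<noteq> 0" using degree_monic_char_poly[OF B] by auto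
    then show ?thesis
      using poly_roots_finite unfolding eigenvalue_root_char_poly[OF B] by blast
  qed
  ultimately have "q c0 \<le> lambda_max B" unfolding lambda_max_def by (intro Max_ge)
  then have "q c0 * N c \<le> lambda_max B * N c"
    by (intro mult_right_mono) (auto simp: N_def sum_nonneg)
  with le[of c] show ?thesis unfolding q_def N_def by linarith
qed

subsection \<open>The oracle inequality in coordinates\<close>

text \<open>An exponential Markov argument in mean form: the positive part of \<open>Q - t\<close>
  is at most \<open>exp (s * (Q - t)) / s\<close>. The threshold \<open>t\<close> makes the exponent
  \<open>- s * t\<close> cancel the growth of the exponential moment down to
  \<open>- L\<close>.\<close>

lemma (in prob_space) expected_excess_sum_squares:
  fixes d d' L v :: real
  assumes "finite I" "0 < v" "real (card I) \<le> d + d'" "d' \<le> L"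
    and G: "\<And>i. i \<in> I \<Longrightarrow> G i \<in> borel_measurable M"
    and mgf: "\<And>c. (\<integral>\<^sup>+\<omega>. ennreal (exp (\<Sum>i\<in>I. c i * G i \<omega>)) \<partial>M) \<le> ennreal (exp (v / 2 * (\<Sum>i\<in>I. (c i)\<^sup>2)))"
  defines "z \<equiv> z_star"
  defines "t \<equiv> v * (z\<^sup>2 / (z - 1) * L + z * (z - 2) / (z - 1) * d)"
  shows "(\<integral>\<^sup>+\<omega>. ennreal ((\<Sum>i\<in>I. (G i \<omega>)\<^sup>2) - t) \<partial>M) \<le> ennreal (2 * z * v / (z - 1) * exp (- L))"
proof -
  note [measurable] = G
  have z: "2 \<le> z" "ln z = z - 2" unfolding z_def by (fact z_star_root)+
  \<comment> \<open>This choice gives \<open>1 - 2 * s * v = 1 / z\<close>, so the moment bound is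
    \<open>z\<close> to the power \<open>card I / 2\<close>, which \<open>ln z = z - 2\<close> turns
    into a plain exponential.\<close>
  define s where "s = (z - 1) / (2 * z * v)"
  have s: "0 < s" "2 * s * v = 1 - 1 / z"
    using z \<open>0 < v\<close> by (auto simp: s_def field_simps)
  have inv_s: "1 / s = 2 * z * v / (z - 1)" by (simp add: s_def)
  let ?Q = "\<lambda>\<omega>. \<Sum>i\<in>I. (G i \<omega>)\<^sup>2"
  have "(\<integral>\<^sup>+\<omega>. ennreal (exp (0 + s * ?Q \<omega>)) \<partial>M) \<le> ennreal (1 * (1 - 2 * s * v) powr (- real (card I) / 2))"
    by (rule mgf_sum_squares) (use assms s z in auto)
  also have "1 * (1 - 2 * s * v) powr (- real (card I) / 2) = exp ((z - 2) * real (card I) / 2)"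
    using z unfolding s by (simp add: powr_def ln_div) (simp add: left_diff_distrib right_diff_distrib mult.commute)
  finally have Q: "(\<integral>\<^sup>+\<omega>. ennreal (exp (s * ?Q \<omega>)) \<partial>M) \<le> ennreal (exp ((z - 2) * real (card I) / 2))" by simp
  have "(\<integral>\<^sup>+\<omega>. ennreal (?Q \<omega> - t) \<partial>M) \<le> (\<integral>\<^sup>+\<omega>. ennreal (1 / s * exp (- (s * t))) * ennreal (exp (s * ?Q \<omega>)) \<partial>M)"
  proof (rule nn_integral_mono)
    fix \<omega>
    \<comment> \<open>Since \<open>ennreal\<close> sends negative reals to 0, a pointwise bound by a
      positive quantity also controls the positive part.\<close>
    have "s * (?Q \<omega> - t) \<le> exp (s * (?Q \<omega> - t))" using exp_ge_add_one_self[of "s * (?Q \<omega> - t)"] by linarith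
    then have "?Q \<omega> - t \<le> 1 / s * exp (s * (?Q \<omega> - t))" using s(1) by (simp add: field_simps)
    also have "\<dots> = 1 / s * exp (- (s * t)) * exp (s * ?Q \<omega>)"
      by (simp add: right_diff_distrib exp_diff exp_minus field_simps)
    finally show "ennreal (?Q \<omega> - t) \<le> ennreal (1 / s * exp (- (s * t))) * ennreal (exp (s * ?Q \<omega>))"
      using s(1) by (simp add: ennreal_leI flip: ennreal_mult)
  qed
  also have "\<dots> = ennreal (1 / s * exp (- (s * t))) * (\<integral>\<^sup>+\<omega>. ennreal (exp (s * ?Q \<omega>)) \<partial>M)"
    by (rule nn_integral_cmult) measurable
  also have "\<dots> \<le> ennreal (1 / s * exp (- (s * t))) * ennreal (exp ((z - 2) * real (card I) / 2))"
    using Q by (rule mult_left_mono) simp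
  also have "\<dots> = ennreal (1 / s * exp (- (s * t) + (z - 2) * real (card I) / 2))"
    using s(1) by (simp add: mult_exp_exp flip: ennreal_mult)
  also have "\<dots> \<le> ennreal (1 / s * exp (- L))"
  proof -
    \<comment> \<open>The value of \<open>w\<close> is \<open>1 / (2 * z)\<close>; it is the common
      factor of both summands of \<open>s * t\<close>.\<close>
    define w where "w = s * v / (z - 1)"
    have w: "w * (2 * z) = 1" using z \<open>0 < v\<close> by (simp add: w_def s_def)
    have "s * t = w * (z\<^sup>2 * L + z * (z - 2) * d)"
      unfolding t_def w_def by (simp add: distrib_left mult.assoc)
    also have "\<dots> = w * (2 * z) * (z / 2 * L + (z - 2) / 2 * d)"
      by (simp add: power2_eq_square field_simps)
    finally have st: "s * t = z / 2 * L + (z - 2) / 2 * d" unfolding w by simp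
    have "(z - 2) * real (card I) \<le> (z - 2) * (d + d')"
      using z assms(3) by (intro mult_left_mono) auto
    moreover have "(z - 2) * d' \<le> (z - 2) * L"
      using z assms(4) by (intro mult_left_mono) auto
    ultimately have "- (s * t) + (z - 2) * real (card I) / 2 \<le> - L"
      unfolding st by (simp add: field_simps)
    then show ?thesis using s(1) by (intro ennreal_leI mult_left_mono) auto
  qed
  finally show ?thesis unfolding inv_s .
qed

text \<open>From \<open>d \<le> L\<close> the first two terms are at most
  \<open>16 * v * z * L\<close>, half of the allowance. The constant \<open>12 * v\<close>, which
  comes from the noise along \<open>h\<close>, is absorbed by the other half when
  \<open>d > 0\<close>, where \<open>z * L \<ge> 2\<close>, and by the surplus in \<open>l\<close>
  when \<open>d = 0\<close>.\<close>

lemma oracle_constants: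
  fixes v L l :: real and d :: nat
  assumes "0 < v" "real d \<le> L" "0 \<le> l" "d = 0 \<Longrightarrow> 1 \<le> l"
  defines "z \<equiv> z_star"
  shows "8 * v * z\<^sup>2 / (z - 1) * L + 8 * v * z * (z - 2) / (z - 1) * real d + 12 * v + 16 * z * v / (z - 1) * l
    \<le> 32 * v * z * L + 32 * z / (z - 1) * v * l"
proof -
  have z: "2 \<le> z" unfolding z_def by (fact z_star_root)
  define w where "w = 1 / (z - 1)"
  have w: "0 \<le> w" "w * (z - 1) = 1" using z by (auto simp: w_def)
  have zw: "1 \<le> z * w" using z by (simp add: w_def)
  have "8 * v * z * (z - 2) * w * real d \<le> 8 * v * z * (z - 2) * w * L"
    using assms w z by (intro mult_left_mono mult_nonneg_nonneg) auto
  moreover have "8 * v * z\<^sup>2 * w * L + 8 * v * z * (z - 2) * w * L = 16 * v * z * L * (w * (z - 1))"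
    by (simp add: power2_eq_square algebra_simps)
  moreover have "12 * v \<le> 16 * v * z * L + 16 * (z * w) * v * l"
  proof -
    have "12 \<le> 16 * z * L + 16 * (z * w) * l"
    proof (cases "d = 0")
      case True
      have "1 * 1 \<le> (z * w) * l" using zw assms(4)[OF True] by (intro mult_mono) auto
      moreover have "0 \<le> z * L" using z assms(2) by auto
      ultimately show ?thesis by simp
    next
      case False
      then have "2 * 1 \<le> z * L" using z assms(2) by (intro mult_mono) auto
      moreover have "0 \<le> (z * w) * l" using zw assms(3) by auto
      ultimately show ?thesis by simp
    qed
    then have "12 * v \<le> (16 * z * L + 16 * (z * w) * l) * v" using assms(1) by (intro mult_right_mono) auto
    then show ?thesis by (simp add: algebra_simps)
  qed
  moreover have "x / (z - 1) = x * w" for x by (simp add: w_def)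
  ultimately show ?thesis unfolding w(2) by (simp add: algebra_simps)
qed

text \<open>Against a fixed competitor \<open>m\<close>, each possible selection \<open>m'\<close>
  gets its own frame, adapted to \<open>m \<union> m'\<close> and \<open>h\<close>. As the selection
  is random, its excess is bounded by the sum of the positive excesses over all \<open>m'\<close>,
  whose expectations are summable with total proportional to the sum of
  \<open>exp (- L m')\<close>.\<close>

lemma (in prob_space) oracle_inequality_coordinates:
  fixes \<nu> :: "'i \<Rightarrow> 'a \<Rightarrow> real" and X :: "'i set \<Rightarrow> 'a \<Rightarrow> 'i \<Rightarrow> real" and S h :: "'i \<Rightarrow> real"
    and v :: real and l :: "'i set \<Rightarrow> real" and sel :: "'a \<Rightarrow> 'i set"
  defines "z \<equiv> z_star"
  defines "pen \<equiv> \<lambda>m. v * (4 * z\<^sup>2 / (z - 1)) * (l m * real (card m))"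
  assumes A: "finite A" "k \<notin> A" and \<M>: "\<M> \<subseteq> Pow A" and l: "\<And>m. m \<in> \<M> \<Longrightarrow> 1 \<le> l m" and v: "0 < v"
    and \<nu>: "\<And>j. j \<in> A \<Longrightarrow> \<nu> j \<in> borel_measurable M"
    and mgf: "\<And>c. (\<integral>\<^sup>+\<omega>. ennreal (exp (ip A c (\<lambda>j. \<nu> j \<omega>))) \<partial>M) \<le> ennreal (exp (v / 2 * ip A c c))"
    and mom: "\<And>c. (\<integral>\<^sup>+\<omega>. ennreal ((ip A c (\<lambda>j. \<nu> j \<omega>))\<^sup>2) \<partial>M) \<le> ennreal (v * ip A c c)"
    and meas: "\<And>m. m \<in> \<M> \<Longrightarrow> (\<lambda>\<omega>. ip A (\<lambda>j. X m \<omega> j - S j) (\<lambda>j. X m \<omega> j - S j)) \<in> borel_measurable M"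
    and supp: "\<And>m \<omega> j. m \<in> \<M> \<Longrightarrow> \<omega> \<in> space M \<Longrightarrow> j \<in> A - m \<Longrightarrow> X m \<omega> j = 0"
    and sel: "\<And>\<omega>. \<omega> \<in> space M \<Longrightarrow> sel \<omega> \<in> \<M>"
    and argmin: "AE \<omega> in M. \<forall>m\<in>\<M>.
      ip A (X (sel \<omega>) \<omega>) (X (sel \<omega>) \<omega>) - 2 * ip A (X (sel \<omega>) \<omega>) (\<lambda>j. S j + h j + \<nu> j \<omega>) + pen (sel \<omega>)
      \<le> ip A (X m \<omega>) (X m \<omega>) - 2 * ip A (X m \<omega>) (\<lambda>j. S j + h j + \<nu> j \<omega>) + pen m"
    and m: "m \<in> \<M>"
  shows "(\<integral>\<^sup>+\<omega>. ennreal (ip A (\<lambda>j. X (sel \<omega>) \<omega> j - S j) (\<lambda>j. X (sel \<omega>) \<omega> j - S j)) \<partial>M)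
    \<le> 7 * (\<integral>\<^sup>+\<omega>. ennreal (ip A (\<lambda>j. X m \<omega> j - S j) (\<lambda>j. X m \<omega> j - S j)) \<partial>M)
      + ennreal (32 * v * z * (l m * real (card m))) + ennreal (8 * ip A h h)
      + ennreal (32 * z / (z - 1) * v * (\<Sum>m\<in>\<M>. exp (- (l m * real (card m)))))"
proof -
  have z: "2 \<le> z" unfolding z_def by (fact z_star_root)
  have fin: "finite \<M>" using \<M> A by (simp add: finite_subset)
  define L where "L m = l m * real (card m)" for m
  have L: "real (card m) \<le> L m" if "m \<in> \<M>" for m
    using l[OF that] unfolding L_def by (simp add: mult_le_cancel_right1)
  \<comment> \<open>The threshold is calibrated so that \<open>8 * t m'\<close> equals
    \<open>2 * pen m'\<close> plus a term depending only on \<open>m\<close>; the penalty of the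
    selected model thus cancels exactly.\<close>
  define t where "t m' = v * (z\<^sup>2 / (z - 1) * L m' + z * (z - 2) / (z - 1) * real (card m))" for m'
  \<comment> \<open>The noise along \<open>h\<close> is the same for every \<open>m'\<close>,
    because \<open>e k\<close> is always the normalized \<open>h\<close>; it therefore enters once,
    outside the sum over models.\<close>
  define g where "g \<omega> = ip A (normalized A h) (\<lambda>j. \<nu> j \<omega>)" for \<omega>
  have meas_ip [measurable]: "(\<lambda>\<omega>. ip A c (\<lambda>j. \<nu> j \<omega>)) \<in> borel_measurable M" for c
    unfolding ip_def using \<nu> by measurable
  let ?err = "\<lambda>m \<omega>. ip A (\<lambda>j. X m \<omega> j - S j) (\<lambda>j. X m \<omega> j - S j)"
  \<comment> \<open>All that is kept of a frame is its sum of squares \<open>Q\<close>, with an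
    expected excess and a pathwise comparison. This lets one \<open>Q\<close> be chosen per model
    while the frames are forgotten.\<close>
  define good where "good m' Q \<longleftrightarrow> Q \<in> borel_measurable M \<and> (\<integral>\<^sup>+\<omega>. ennreal (Q \<omega> - t m') \<partial>M) \<le> ennreal (2 * z * v / (z - 1) * exp (- L m')) \<and>
      (\<forall>\<omega>\<in>space M. \<forall>P P'. ip A (X m' \<omega>) (X m' \<omega>) - 2 * ip A (X m' \<omega>) (\<lambda>j. S j + h j + \<nu> j \<omega>) + P'
          \<le> ip A (X m \<omega>) (X m \<omega>) - 2 * ip A (X m \<omega>) (\<lambda>j. S j + h j + \<nu> j \<omega>) + P \<longrightarrow>
        ?err m' \<omega> \<le> 7 * ?err m \<omega> + 8 * ip A h h + 12 * (g \<omega>)\<^sup>2 + 8 * Q \<omega> + 2 * P - 2 * P')"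
    for m' Q
  have "\<exists>Q. good m' Q" if m': "m' \<in> \<M>" for m'
  proof -
    \<comment> \<open>The difference \<open>X m' - X m\<close> is supported on this union, at every
      outcome.\<close>
    let ?I = "m \<union> m'"
    have I: "?I \<subseteq> A" using m m' \<M> by auto
    have finI: "finite ?I" and k: "k \<notin> ?I" using I A finite_subset by blast+
    show ?thesis
    proof (rule adapted_frame[OF A(1) I k, of h])
    fix e :: "'i \<Rightarrow> 'i \<Rightarrow> real"
    assume e:
      "\<And>c J. J \<subseteq> insert k ?I \<Longrightarrow> ip A (\<lambda>a. \<Sum>i\<in>J. c i * e i a) (\<lambda>a. \<Sum>i\<in>J. c i * e i a) \<le> (\<Sum>i\<in>J. (c i)\<^sup>2)"
      "\<And>u y. (\<And>a. a \<in> A - ?I \<Longrightarrow> u a = 0) \<Longrightarrow> ip A u y = (\<Sum>i\<in>insert k ?I. ip A u (e i) * ip A (e i) y)"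
      "\<And>i. i \<in> ?I \<Longrightarrow> ip A (e i) h = 0"
      "(ip A (e k) h)\<^sup>2 = ip A h h"
      "e k = normalized A h"
    let ?Q = "\<lambda>\<omega>. \<Sum>i\<in>?I. (ip A (e i) (\<lambda>j. \<nu> j \<omega>))\<^sup>2"
    show ?thesis unfolding good_def
    proof (intro exI[of _ ?Q] conjI ballI allI impI)
      show "?Q \<in> borel_measurable M" by measurable
    next
      show "(\<integral>\<^sup>+\<omega>. ennreal (?Q \<omega> - t m') \<partial>M) \<le> ennreal (2 * z * v / (z - 1) * exp (- L m'))"
        unfolding t_def z_def
      proof (rule expected_excess_sum_squares)
        show "real (card ?I) \<le> real (card m) + real (card m')"
          using card_Un_le[of m m'] by (simp flip: of_nat_add)
        show "real (card m') \<le> L m'" by (rule L[OF m'])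
        fix c :: "'i \<Rightarrow> real"
        have "(\<Sum>i\<in>?I. c i * ip A (e i) (\<lambda>j. \<nu> j \<omega>)) = ip A (\<lambda>a. \<Sum>i\<in>?I. c i * e i a) (\<lambda>j. \<nu> j \<omega>)" for \<omega>
          by (simp only: ip_sum_left ip_scale_left)
        then have "(\<integral>\<^sup>+\<omega>. ennreal (exp (\<Sum>i\<in>?I. c i * ip A (e i) (\<lambda>j. \<nu> j \<omega>))) \<partial>M) \<le>
            ennreal (exp (v / 2 * ip A (\<lambda>a. \<Sum>i\<in>?I. c i * e i a) (\<lambda>a. \<Sum>i\<in>?I. c i * e i a)))"
          by (simp only: mgf)
        also have "\<dots> \<le> ennreal (exp (v / 2 * (\<Sum>i\<in>?I. (c i)\<^sup>2)))"
          using v e(1)[of ?I c] by (intro ennreal_leI exp_le_cancel_iff[THEN iffD2] mult_left_mono) auto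
        finally show "(\<integral>\<^sup>+\<omega>. ennreal (exp (\<Sum>i\<in>?I. c i * ip A (e i) (\<lambda>j. \<nu> j \<omega>))) \<partial>M)
          \<le> ennreal (exp (v / 2 * (\<Sum>i\<in>?I. (c i)\<^sup>2)))" .
      qed (use finI v in auto)
    next
      fix \<omega> P P'
      assume \<omega>: "\<omega> \<in> space M"
        and le: "ip A (X m' \<omega>) (X m' \<omega>) - 2 * ip A (X m' \<omega>) (\<lambda>j. S j + h j + \<nu> j \<omega>) + P'
          \<le> ip A (X m \<omega>) (X m \<omega>) - 2 * ip A (X m \<omega>) (\<lambda>j. S j + h j + \<nu> j \<omega>) + P"
      have "X m' \<omega> a - X m \<omega> a = 0" if "a \<in> A - ?I" for a
        using supp[OF m \<omega>, of a] supp[OF m' \<omega>, of a] that by auto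
      then show "?err m' \<omega> \<le> 7 * ?err m \<omega> + 8 * ip A h h + 12 * (g \<omega>)\<^sup>2 + 8 * ?Q \<omega> + 2 * P - 2 * P'"
        unfolding g_def e(5)[symmetric]
        by (intro contrast_comparison[where k = k] A finI k e(2-4) le)
    qed
    qed
  qed
  then have "\<forall>m'\<in>\<M>. \<exists>Q. good m' Q" by blast
  then obtain Q where Q: "\<forall>m'\<in>\<M>. good m' (Q m')" by (rule bchoice[THEN exE])
  have Q_meas: "Q m' \<in> borel_measurable M" if "m' \<in> \<M>" for m'
    using bspec[OF Q that] unfolding good_def by (rule conjunct1)
  have Q_int: "(\<integral>\<^sup>+\<omega>. ennreal (Q m' \<omega> - t m') \<partial>M) \<le> ennreal (2 * z * v / (z - 1) * exp (- L m'))"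
    if "m' \<in> \<M>" for m'
    using bspec[OF Q that] unfolding good_def by (elim conjE)
  have Q_err: "?err m' \<omega> \<le> 7 * ?err m \<omega> + 8 * ip A h h + 12 * (g \<omega>)\<^sup>2 + 8 * Q m' \<omega> + 2 * P - 2 * P'"
    if "m' \<in> \<M>" "\<omega> \<in> space M"
      "ip A (X m' \<omega>) (X m' \<omega>) - 2 * ip A (X m' \<omega>) (\<lambda>j. S j + h j + \<nu> j \<omega>) + P'
        \<le> ip A (X m \<omega>) (X m \<omega>) - 2 * ip A (X m \<omega>) (\<lambda>j. S j + h j + \<nu> j \<omega>) + P" for m' \<omega> P P'
    using bspec[OF Q that(1)] that(2,3) unfolding good_def by blast
  note [measurable] = Q_meas meas[OF m]
  define c where "c = 8 * v * z\<^sup>2 / (z - 1) * L m + 8 * v * z * (z - 2) / (z - 1) * real (card m)"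
  have "0 \<le> L m" using L[OF m] of_nat_0_le_iff[of "card m"] by linarith
  then have c: "0 \<le> c" unfolding c_def using v z by (intro add_nonneg_nonneg mult_nonneg_nonneg divide_nonneg_nonneg) auto
  have "AE \<omega> in M. ennreal (?err (sel \<omega>) \<omega>) \<le>
      7 * ennreal (?err m \<omega>) + (ennreal (8 * ip A h h + c) + (12 * ennreal ((g \<omega>)\<^sup>2) + 8 * (\<Sum>m'\<in>\<M>. ennreal (Q m' \<omega> - t m'))))"
    using argmin AE_space
  proof eventually_elim
    case (elim \<omega>)
    note \<omega> = elim(2)
    let ?m = "sel \<omega>"
    have sm: "?m \<in> \<M>" by (rule sel[OF \<omega>])
    have 1: "?err ?m \<omega> \<le> 7 * ?err m \<omega> + 8 * ip A h h + 12 * (g \<omega>)\<^sup>2 + 8 * Q ?m \<omega> + 2 * pen m - 2 * pen ?m"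
      by (rule Q_err[OF sm \<omega>]) (use elim m in auto)
    have 2: "8 * Q ?m \<omega> + 2 * pen m - 2 * pen ?m = 8 * (Q ?m \<omega> - t ?m) + c"
      unfolding pen_def t_def c_def L_def[symmetric] by (simp add: algebra_simps)
    \<comment> \<open>Passing to the sum of positive parts removes the random index: the resulting
      upper bound no longer contains \<open>sel\<close>.\<close>
    define R where "R = (\<Sum>m'\<in>\<M>. max 0 (Q m' \<omega> - t m'))"
    have 3: "Q ?m \<omega> - t ?m \<le> R"
      using member_le_sum[OF sm _ fin, of "\<lambda>m'. max 0 (Q m' \<omega> - t m')"] by (simp add: R_def)
    from 1 2 3 have "?err ?m \<omega> \<le> 7 * ?err m \<omega> + ((8 * ip A h h + c) + (12 * (g \<omega>)\<^sup>2 + 8 * R))"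
    proof -
      have "e \<le> 7 * b + ((H + c) + (G + 8 * R))"
        if "e \<le> 7 * b + H + G + 8 * q + 2 * p - 2 * p'" "8 * q + 2 * p - 2 * p' = 8 * (q - u) + c" "q - u \<le> R"
        for e b H G q p p' u :: real using that by argo
      from this[OF 1 2 3] show ?thesis .
    qed
    then have "ennreal (?err ?m \<omega>) \<le> ennreal (7 * ?err m \<omega> + ((8 * ip A h h + c) + (12 * (g \<omega>)\<^sup>2 + 8 * R)))"
      by (rule ennreal_leI)
    also have "\<dots> = 7 * ennreal (?err m \<omega>) + (ennreal (8 * ip A h h + c) + (12 * ennreal ((g \<omega>)\<^sup>2) + 8 * (\<Sum>m'\<in>\<M>. ennreal (max 0 (Q m' \<omega> - t m')))))"
      using c ip_self_nonneg[of A] unfolding R_def by (simp add: ennreal_plus ennreal_mult sum_nonneg sum_ennreal del: ennreal_max_0)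
    finally show ?case by simp
  qed
  then have "(\<integral>\<^sup>+\<omega>. ennreal (?err (sel \<omega>) \<omega>) \<partial>M) \<le> (\<integral>\<^sup>+\<omega>.
      7 * ennreal (?err m \<omega>) + (ennreal (8 * ip A h h + c) + (12 * ennreal ((g \<omega>)\<^sup>2) + 8 * (\<Sum>m'\<in>\<M>. ennreal (Q m' \<omega> - t m')))) \<partial>M)"
    by (rule nn_integral_mono_AE)
  also have "\<dots> = 7 * (\<integral>\<^sup>+\<omega>. ennreal (?err m \<omega>) \<partial>M) + (ennreal (8 * ip A h h + c) +
      (12 * (\<integral>\<^sup>+\<omega>. ennreal ((g \<omega>)\<^sup>2) \<partial>M) + 8 * (\<Sum>m'\<in>\<M>. \<integral>\<^sup>+\<omega>. ennreal (Q m' \<omega> - t m') \<partial>M)))"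
    unfolding g_def by (simp add: nn_integral_add nn_integral_cmult nn_integral_sum emeasure_space_1)
  also have "\<dots> \<le> 7 * (\<integral>\<^sup>+\<omega>. ennreal (?err m \<omega>) \<partial>M) + (ennreal (8 * ip A h h + c) +
      (12 * ennreal v + 8 * (\<Sum>m'\<in>\<M>. ennreal (2 * z * v / (z - 1) * exp (- L m')))))"
  proof -
    have "(\<integral>\<^sup>+\<omega>. ennreal ((g \<omega>)\<^sup>2) \<partial>M) \<le> ennreal (v * ip A (normalized A h) (normalized A h))"
      unfolding g_def by (rule mom)
    also have "\<dots> \<le> ennreal (v * 1)"
      using v by (intro ennreal_leI mult_left_mono ip_normalized_le_1) auto
    finally have "(\<integral>\<^sup>+\<omega>. ennreal ((g \<omega>)\<^sup>2) \<partial>M) \<le> ennreal v" by simp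
    then show ?thesis by (intro add_left_mono add_mono mult_left_mono sum_mono Q_int) auto
  qed
  also have "\<dots> = 7 * (\<integral>\<^sup>+\<omega>. ennreal (?err m \<omega>) \<partial>M) +
      ennreal ((8 * ip A h h + c) + (12 * v + 8 * (\<Sum>m'\<in>\<M>. 2 * z * v / (z - 1) * exp (- L m'))))"
    using c ip_self_nonneg[of A h] v z by (simp add: ennreal_plus ennreal_mult sum_nonneg flip: sum_ennreal)
  also have "\<dots> \<le> 7 * (\<integral>\<^sup>+\<omega>. ennreal (?err m \<omega>) \<partial>M) +
      ennreal (32 * v * z * L m + 8 * ip A h h + 32 * z / (z - 1) * v * (\<Sum>m'\<in>\<M>. exp (- L m')))"
  proof (intro add_left_mono ennreal_leI)
    let ?l = "\<Sum>m'\<in>\<M>. exp (- L m')"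
    \<comment> \<open>The empty model has \<open>L m = 0\<close>, so its own summand already equals
      1.\<close>
    have "1 \<le> ?l" if "card m = 0"
    proof -
      have "exp (- L m) \<le> ?l" using m fin by (intro member_le_sum) auto
      with that show ?thesis by (simp add: L_def)
    qed
    then have "8 * v * z\<^sup>2 / (z - 1) * L m + 8 * v * z * (z - 2) / (z - 1) * real (card m) + 12 * v + 16 * z * v / (z - 1) * ?l
      \<le> 32 * v * z * L m + 32 * z / (z - 1) * v * ?l"
      unfolding z_def by (intro oracle_constants v L m sum_nonneg) auto
    moreover have "8 * (\<Sum>m'\<in>\<M>. 2 * z * v / (z - 1) * exp (- L m')) = 16 * z * v / (z - 1) * ?l"
      by (simp add: sum_distrib_left sum_divide_distrib mult_ac)
    ultimately show "(8 * ip A h h + c) + (12 * v + 8 * (\<Sum>m'\<in>\<M>. 2 * z * v / (z - 1) * exp (- L m')))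
      \<le> 32 * v * z * L m + 8 * ip A h h + 32 * z / (z - 1) * v * ?l"
      unfolding c_def by linarith
  qed
  also have "\<dots> = 7 * (\<integral>\<^sup>+\<omega>. ennreal (?err m \<omega>) \<partial>M) + ennreal (32 * v * z * L m) + ennreal (8 * ip A h h)
      + ennreal (32 * z / (z - 1) * v * (\<Sum>m'\<in>\<M>. exp (- L m')))"
    using \<open>0 \<le> L m\<close> v z ip_self_nonneg[of A h] by (simp add: ennreal_plus sum_nonneg add.assoc)
  finally show ?thesis unfolding L_def .
qed

subsection \<open>Reduction to coordinates\<close>

lemma periodic_one_shift:
  assumes "periodic_one f"
  shows "f (t + real k) = f t"
proof (induction k)
  case (Suc k)
  have "f (t + real (Suc k)) = f ((t + real k) + 1)" by (simp add: algebra_simps)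
  with Suc assms show ?case by (simp add: periodic_one_def)
qed simp

lemma sum_grid_periodic:
  assumes "periodic_one f" "0 < p"
  shows "(\<Sum>k=1..n * p. f (grid p k)) = real n * (\<Sum>k=1..p. f (grid p k))"
proof (induction n)
  case (Suc n)
  have "(\<Sum>k=1..Suc n * p. f (grid p k)) = (\<Sum>k=1..n * p + p. f (grid p k))"
    by (simp add: add.commute)
  also have "\<dots> = (\<Sum>k=1..n * p. f (grid p k)) + (\<Sum>k=n * p + 1..n * p + p. f (grid p k))"
    by (rule sum.ub_add_nat) simp
  also have "(\<Sum>k=n * p + 1..n * p + p. f (grid p k)) = (\<Sum>k=1..p. f (grid p (k + n * p)))"
    using sum.shift_bounds_cl_nat_ivl[of "\<lambda>k. f (grid p k)" 1 "n * p" p] by (simp add: add.commute)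
  also have "\<dots> = (\<Sum>k=1..p. f (grid p k))"
  proof (rule sum.cong[OF refl])
    fix k
    have "grid p (k + n * p) = grid p k + real n"
      using assms(2) by (simp add: grid_def field_simps)
    then show "f (grid p (k + n * p)) = f (grid p k)" using periodic_one_shift[OF assms(1)] by simp
  qed
  finally show ?case using Suc by (simp add: algebra_simps)
qed simp

lemma periodic_integrable_on:
  fixes f :: "real \<Rightarrow> real"
  assumes "periodic_one f" "f integrable_on {0..1}"
  shows "f integrable_on {0..real n}"
proof (induction n)
  case (Suc n)
  have "f \<circ> (+) (real n) = f" using periodic_one_shift[OF assms(1)] by (auto simp: add.commute)
  then have "f integrable_on {0 + real n..1 + real n}"
    using assms(2) integrable_on_shift_Icc_real[of f "real n" 0 1] by simp
  with Suc have "f integrable_on {0..1 + real n}"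
    by (intro Henstock_Kurzweil_Integration.integrable_combine[where a = 0 and c = "real n" and b = "1 + real n"]) auto
  then show ?case by (simp add: add.commute)
qed (use integrable_on_refl[of f 0] in simp)

text \<open>The model integrates \<open>S\<close> over intervals beyond the unit one. On
  \<open>{0..1}\<close> integrability follows from
  \<open>\<bar>S t\<bar> \<le> 1 + (S t)\<^sup>2\<close>; periodicity extends it by gluing
  translates, for \<open>S\<close> and its absolute value separately.\<close>

lemma square_integrable_unit_set_integrable:
  assumes "periodic_one S" "square_integrable_unit S" "0 \<le> a"
  shows "set_integrable lebesgue {a..b} S"
proof -
  have "set_integrable lebesgue {0..1} (\<lambda>t. 1 + (S t)\<^sup>2)"
    using assms(2) unfolding square_integrable_unit_def
    by (intro set_integral_add) (auto simp: set_integrable_def)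
  then have S: "set_integrable lebesgue {0..1} S"
  proof (rule set_integrable_bound)
    show "set_borel_measurable lebesgue {0..1} S"
      using assms(2) by (simp add: square_integrable_unit_def)
    have "norm (S t) \<le> norm (1 + (S t)\<^sup>2)" for t
    proof -
      have "0 \<le> (\<bar>S t\<bar> - 1)\<^sup>2" by simp
      then have "2 * \<bar>S t\<bar> \<le> 1 + (S t)\<^sup>2" by (simp add: power2_diff)
      then show ?thesis using abs_ge_zero[of "S t"] by simp
    qed
    then show "AE t in lebesgue. t \<in> {0..1} \<longrightarrow> norm (S t) \<le> norm (1 + (S t)\<^sup>2)" by simp
  qed
  then have "S integrable_on {0..1}" "(\<lambda>t. norm (S t)) integrable_on {0..1}"
    by (simp_all add: absolutely_integrable_on_def)
  moreover obtain n where "b \<le> real n" using real_arch_simple by blast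
  moreover have "periodic_one (\<lambda>t. norm (S t))" using assms(1) by (simp add: periodic_one_def)
  ultimately have "S integrable_on {0..real n}" "(\<lambda>t. norm (S t)) integrable_on {0..real n}"
    using assms(1) by (simp_all only: periodic_integrable_on)
  moreover have "{a..b} \<subseteq> {0..real n}" using assms(3) \<open>b \<le> real n\<close> by auto
  ultimately show ?thesis
    unfolding absolutely_integrable_on_def using integrable_on_subinterval by blast
qed

text \<open>The average of \<open>S\<close> over the cell of length \<open>1 / p\<close> ending at
  \<open>t\<close>. Taking it at every real \<open>t\<close> makes it a periodic function, to which
  Parseval applies; at the grid points it is the signal plus the discretization error.\<close>

definition cell_mean :: "nat \<Rightarrow> (real \<Rightarrow> real) \<Rightarrow> real \<Rightarrow> real" where
  "cell_mean p S t = real p * integral {t - 1 / real p..t} S"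

lemma periodic_cell_mean:
  assumes "periodic_one S"
  shows "periodic_one (cell_mean p S)"
proof -
  have "S \<circ> (+) 1 = S" using assms by (auto simp: periodic_one_def add.commute)
  then have "integral {t + 1 - 1 / real p..t + 1} S = integral {t - 1 / real p..t} S" for t
    using integral_shift_Icc_real[of "t - 1 / real p" t S 1] by (simp add: algebra_simps)
  then show ?thesis by (simp add: periodic_one_def cell_mean_def)
qed

lemma grid_step:
  assumes "0 < p" "1 \<le> k"
  shows "grid p (k - 1) = grid p k - 1 / real p" "0 \<le> grid p (k - 1)" "grid p (k - 1) \<le> grid p k"
  using assms by (auto simp: grid_def field_simps of_nat_diff)

lemma drift_increment:
  assumes "periodic_one S" "square_integrable_unit S" "0 < p" "1 \<le> k"
  shows "(LINT s:{0..grid p k}|lebesgue. S s) - (LINT s:{0..grid p (k - 1)}|lebesgue. S s)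
    = cell_mean p S (grid p k) / real p"
proof -
  note si = square_integrable_unit_set_integrable[OF assms(1,2)]
  note g = grid_step[OF assms(3,4)]
  have "integral {0..grid p (k - 1)} S + integral {grid p (k - 1)..grid p k} S = integral {0..grid p k} S"
    using g by (intro Henstock_Kurzweil_Integration.integral_combine set_lebesgue_integral_eq_integral(1) si) auto
  then show ?thesis
    using assms(3) g(1) by (simp add: set_lebesgue_integral_eq_integral(2)[OF si] cell_mean_def)
qed

lemma discr_h_eq:
  assumes "periodic_one S" "square_integrable_unit S" "0 < p" "1 \<le> k"
  shows "discr_h p S k = cell_mean p S (grid p k) - S (grid p k)"
proof -
  note si = square_integrable_unit_set_integrable[OF assms(1,2)]
  note g = grid_step[OF assms(3,4)]
  have "(LINT t:{grid p (k - 1)..grid p k}|lebesgue. S t - S (grid p k)) =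
      (LINT t:{grid p (k - 1)..grid p k}|lebesgue. S t) - (LINT t:{grid p (k - 1)..grid p k}|lebesgue. S (grid p k))"
    using g by (intro set_integral_diff si) (auto simp: set_integrable_def)
  also have "\<dots> = integral {grid p (k - 1)..grid p k} S - S (grid p k) / real p"
    using g by (subst set_lebesgue_integral_eq_integral(2)[OF si]) (auto simp: set_lebesgue_integral_def)
  finally show ?thesis
    unfolding discr_h_def cell_mean_def g(1) using assms(3) by (simp add: right_diff_distrib)
qed

section \<open>Basis coefficients and Parseval's identity\<close>

definition coef :: "nat \<Rightarrow> (nat \<Rightarrow> real \<Rightarrow> real) \<Rightarrow> (real \<Rightarrow> real) \<Rightarrow> nat \<Rightarrow> real" where
  "coef p \<phi> f j = inner_p p f (\<phi> j)"

lemma inner_p_ip: "inner_p p x z = ip {1..p} (\<lambda>j. x (grid p j)) (\<lambda>j. z (grid p j)) / real p"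
  by (simp add: inner_p_def ip_def)

lemma inner_p_sum_left: "inner_p p (\<lambda>t. \<Sum>j\<in>J. c j * f j t) z = (\<Sum>j\<in>J. c j * inner_p p (f j) z)"
  unfolding inner_p_ip ip_sum_left ip_scale_left by (simp add: sum_divide_distrib)

lemma coef_diff: "coef p \<phi> (\<lambda>t. f t - g t) j = coef p \<phi> f j - coef p \<phi> g j"
  by (simp add: coef_def inner_p_ip ip_diff_left diff_divide_distrib)

lemma coef_combination:
  assumes "orthonormal_basis_p p \<phi>" "m \<subseteq> {1..p}" "j \<in> {1..p}"
  shows "coef p \<phi> (\<lambda>t. \<Sum>i\<in>m. c i * \<phi> i t) j = (if j \<in> m then c j else 0)"
proof -
  have "coef p \<phi> (\<lambda>t. \<Sum>i\<in>m. c i * \<phi> i t) j = (\<Sum>i\<in>m. c i * inner_p p (\<phi> i) (\<phi> j))"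
    unfolding coef_def by (rule inner_p_sum_left)
  also have "\<dots> = (\<Sum>i\<in>m. if i = j then c j else 0)"
    using assms by (intro sum.cong) (auto simp: orthonormal_basis_p_def)
  finally show ?thesis using finite_subset[OF assms(2)] by simp
qed

text \<open>The spanning property expands \<open>f\<close> at the grid points, and orthonormality
  identifies the coefficients of that expansion as \<open>coef\<close>.\<close>

lemma parseval:
  assumes "orthonormal_basis_p p \<phi>" "periodic_one f"
  shows "inner_p p f g = ip {1..p} (coef p \<phi> f) (coef p \<phi> g)"
proof -
  obtain c where c: "\<And>l. l \<in> {1..p} \<Longrightarrow> f (grid p l) = (\<Sum>j=1..p. c j * \<phi> j (grid p l))"
    using assms unfolding orthonormal_basis_p_def by blast
  have f: "inner_p p f z = inner_p p (\<lambda>t. \<Sum>j=1..p. c j * \<phi> j t) z" for z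
    unfolding inner_p_def using c by simp
  have "coef p \<phi> f j = c j" if "j \<in> {1..p}" for j
    using coef_combination[OF assms(1) order_refl that, of c] that unfolding coef_def f by simp
  moreover have "inner_p p f g = (\<Sum>j=1..p. c j * coef p \<phi> g j)"
    unfolding f inner_p_sum_left coef_def
    by (simp add: inner_p_def mult.commute)
  ultimately show ?thesis by (simp add: ip_def)
qed

text \<open>The drift part of the sum is periodic and collapses to \<open>n\<close> copies of one
  period, hence to an inner product. The noise part is not periodic; expanding \<open>x\<close> in
  the basis turns it into the variables \<open>zeta\<close>, and dividing by \<open>n\<close> leaves
  \<open>zeta / sqrt n\<close>. Finally \<open>g\<close> is split as
  \<open>S + (g - S)\<close>.\<close>

lemma contrast_in_coordinates:
  assumes \<phi>: "orthonormal_basis_p p \<phi>" and m: "m \<subseteq> {1..p}" and x: "x \<in> model_space \<phi> m"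
    and p: "0 < p" and n: "0 < n" and S: "periodic_one S" and g: "periodic_one g"
    and incr: "\<And>k. k \<in> {1..n * p} \<Longrightarrow>
      v k - v (k - 1) = g (grid p k) / real p + (\<xi> (grid p k) \<omega> - \<xi> (grid p (k - 1)) \<omega>)"
  shows "contrast n p v x = ip {1..p} (coef p \<phi> x) (coef p \<phi> x)
    - 2 * ip {1..p} (coef p \<phi> x) (\<lambda>j. coef p \<phi> S j + coef p \<phi> (\<lambda>t. g t - S t) j + zeta \<phi> \<xi> n p j \<omega> / sqrt (real n))"
proof -
  obtain c where c: "x = (\<lambda>t. \<Sum>j\<in>m. c j * \<phi> j t)" using x by (auto simp: model_space_def)
  have \<phi>_per: "\<And>j. j \<in> m \<Longrightarrow> periodic_one (\<phi> j)" using \<phi> m by (auto simp: orthonormal_basis_p_def)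
  then have x_per: "periodic_one x" unfolding c by (simp add: periodic_one_def)
  define \<delta> where "\<delta> k = \<xi> (grid p k) \<omega> - \<xi> (grid p (k - 1)) \<omega>" for k
  have "(\<Sum>k=1..n * p. x (grid p k) * (v k - v (k - 1)))
      = (\<Sum>k=1..n * p. x (grid p k) * g (grid p k) / real p) + (\<Sum>k=1..n * p. x (grid p k) * \<delta> k)"
    using incr by (simp add: \<delta>_def distrib_left sum.distrib)
  also have "(\<Sum>k=1..n * p. x (grid p k) * g (grid p k) / real p) = real n * inner_p p x g"
    using sum_grid_periodic[of "\<lambda>t. x t * g t / real p" p n] x_per g p
    by (simp add: periodic_one_def inner_p_def sum_divide_distrib)
  also have "inner_p p x g = ip {1..p} (coef p \<phi> x) (coef p \<phi> g)" by (rule parseval[OF \<phi> x_per])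
  also have "(\<Sum>k=1..n * p. x (grid p k) * \<delta> k) = (\<Sum>j\<in>m. c j * (\<Sum>k=1..n * p. \<phi> j (grid p k) * \<delta> k))"
    unfolding c sum_distrib_right sum_distrib_left mult.assoc by (rule sum.swap)
  also have "\<dots> = (\<Sum>j\<in>m. c j * (sqrt (real n) * zeta \<phi> \<xi> n p j \<omega>))"
    using n by (simp add: zeta_def \<delta>_def)
  also have "\<dots> = (\<Sum>j\<in>{1..p}. coef p \<phi> x j * (sqrt (real n) * zeta \<phi> \<xi> n p j \<omega>))"
    using m coef_combination[OF \<phi> m, of _ c] unfolding c
    by (intro sum.mono_neutral_cong_left) auto
  also have "\<dots> = real n * ip {1..p} (coef p \<phi> x) (\<lambda>j. zeta \<phi> \<xi> n p j \<omega> / sqrt (real n))"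
    unfolding ip_def sum_distrib_left using n by (intro sum.cong) (auto simp: field_simps)
  finally show ?thesis
    using n unfolding contrast_def normsq_p_def parseval[OF \<phi> x_per, of x] coef_diff
    by (simp add: ip_add_right algebra_simps)
qed

section \<open>Moments of the projected noise\<close>

lemma (in prob_space) gaussian_noise_rv:
  assumes "gaussian_noise M \<xi>" "0 \<le> t"
  shows "integrable M (\<xi> t)" "expectation (\<xi> t) = 0"
proof -
  have "jointly_gaussian M {0..} \<xi>" using assms by (simp add: gaussian_noise_def)
  then have "gaussian_rv M (\<lambda>\<omega>. \<Sum>i\<in>{t}. 1 * \<xi> i \<omega>)"
    unfolding jointly_gaussian_def using assms(2) by (auto dest!: spec[of _ "{t}"] spec[of _ "\<lambda>_. 1"])
  then have "gaussian_rv M (\<xi> t)" by simp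
  then show "integrable M (\<xi> t)" by (rule gaussian_rv_square_integrable)
  show "expectation (\<xi> t) = 0" using assms by (simp add: gaussian_noise_def)
qed

lemma (in prob_space) zeta_mean:
  assumes "gaussian_noise M \<xi>"
  shows "integrable M (zeta \<phi> \<xi> n p j)" "expectation (zeta \<phi> \<xi> n p j) = 0"
proof -
  have \<xi>: "integrable M (\<xi> (grid p k))" "expectation (\<xi> (grid p k)) = 0" for k
    using gaussian_noise_rv[OF assms, of "grid p k"] by (simp_all add: grid_def)
  show "integrable M (zeta \<phi> \<xi> n p j)"
    unfolding zeta_def[abs_def] by (intro integrable_mult_right Bochner_Integration.integrable_sum Bochner_Integration.integrable_diff \<xi>)
  show "expectation (zeta \<phi> \<xi> n p j) = 0"
    unfolding zeta_def[abs_def]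
    by (simp add: \<xi> Bochner_Integration.integral_sum Bochner_Integration.integral_diff)
qed

text \<open>\<open>Y\<close> is a centred Gaussian variable whose variance is the quadratic form of
  the covariance matrix at \<open>c / sqrt n\<close>. The Rayleigh bound controls this variance, and
  both moments follow from it.\<close>

lemma (in prob_space) noise_moments:
  fixes \<phi> :: "nat \<Rightarrow> real \<Rightarrow> real" and c :: "nat \<Rightarrow> real"
  assumes noise: "gaussian_noise M \<xi>" and gauss: "jointly_gaussian M {1..p} (zeta \<phi> \<xi> n p)"
    and lam: "lambda_max (cov_mat M \<phi> \<xi> n p) \<le> lam" and p: "0 < p" and n: "0 < n"
  defines "Y \<equiv> \<lambda>\<omega>. ip {1..p} c (\<lambda>j. zeta \<phi> \<xi> n p j \<omega> / sqrt (real n))"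
  shows "(\<integral>\<^sup>+\<omega>. ennreal (exp (Y \<omega>)) \<partial>M) \<le> ennreal (exp (lam / real n / 2 * ip {1..p} c c))"
    and "(\<integral>\<^sup>+\<omega>. ennreal ((Y \<omega>)\<^sup>2) \<partial>M) \<le> ennreal (lam / real n * ip {1..p} c c)"
proof -
  let ?\<zeta> = "zeta \<phi> \<xi> n p"
  define b where "b j = c j / sqrt (real n)" for j
  have Y: "Y = (\<lambda>\<omega>. \<Sum>j\<in>{1..p}. b j * ?\<zeta> j \<omega>)"
    unfolding Y_def ip_def b_def by (simp add: field_simps)
  have lin: "gaussian_rv M (\<lambda>\<omega>. \<Sum>j\<in>J. a j * ?\<zeta> j \<omega>)" if "J \<subseteq> {1..p}" for J a
    using gauss that finite_subset[OF that] unfolding jointly_gaussian_def by blast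
  have Y_gauss: "gaussian_rv M Y" unfolding Y by (rule lin) simp
  have \<zeta>2: "integrable M (\<lambda>\<omega>. (?\<zeta> j \<omega>)\<^sup>2)" and \<zeta>_meas: "?\<zeta> j \<in> borel_measurable M" if "j \<in> {1..p}" for j
  proof -
    have "gaussian_rv M (\<lambda>\<omega>. \<Sum>i\<in>{j}. 1 * ?\<zeta> i \<omega>)" using that by (intro lin) auto
    then have "gaussian_rv M (?\<zeta> j)" by simp
    then show "integrable M (\<lambda>\<omega>. (?\<zeta> j \<omega>)\<^sup>2)" "?\<zeta> j \<in> borel_measurable M"
      by (rule gaussian_rv_square_integrable(2), simp add: gaussian_rv_def)
  qed
  have prod_int: "integrable M (\<lambda>\<omega>. ?\<zeta> i \<omega> * ?\<zeta> j \<omega>)" if "i \<in> {1..p}" "j \<in> {1..p}" for i j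
  proof (rule Bochner_Integration.integrable_bound)
    show "integrable M (\<lambda>\<omega>. (?\<zeta> i \<omega>)\<^sup>2 + (?\<zeta> j \<omega>)\<^sup>2)" using that \<zeta>2 by simp
    have "norm (x * y) \<le> norm (x\<^sup>2 + y\<^sup>2)" for x y :: real
    proof -
      have "0 \<le> (\<bar>x\<bar> - \<bar>y\<bar>)\<^sup>2" by simp
      then have "2 * (\<bar>x\<bar> * \<bar>y\<bar>) \<le> x\<^sup>2 + y\<^sup>2" by (simp add: power2_diff)
      moreover have "0 \<le> \<bar>x\<bar> * \<bar>y\<bar>" by simp
      ultimately have "\<bar>x\<bar> * \<bar>y\<bar> \<le> x\<^sup>2 + y\<^sup>2" by linarith
      then show ?thesis by (simp add: abs_mult)
    qed
    then show "AE \<omega> in M. norm (?\<zeta> i \<omega> * ?\<zeta> j \<omega>) \<le> norm ((?\<zeta> i \<omega>)\<^sup>2 + (?\<zeta> j \<omega>)\<^sup>2)" by simp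
    show "(\<lambda>\<omega>. ?\<zeta> i \<omega> * ?\<zeta> j \<omega>) \<in> borel_measurable M"
      using that \<zeta>_meas by measurable
  qed
  have mean: "expectation Y = 0"
    unfolding Y using zeta_mean[OF noise] by (simp add: Bochner_Integration.integral_sum)
  let ?B = "cov_mat M \<phi> \<xi> n p"
  have "expectation (\<lambda>\<omega>. (Y \<omega>)\<^sup>2) = expectation (\<lambda>\<omega>. \<Sum>i\<in>{1..p}. \<Sum>j\<in>{1..p}. b i * b j * (?\<zeta> i \<omega> * ?\<zeta> j \<omega>))"
    unfolding Y power2_eq_square sum_product by (simp add: mult_ac)
  also have "\<dots> = (\<Sum>i\<in>{1..p}. \<Sum>j\<in>{1..p}. b i * b j * expectation (\<lambda>\<omega>. ?\<zeta> i \<omega> * ?\<zeta> j \<omega>))"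
  proof (subst Bochner_Integration.integral_sum)
    show "integrable M (\<lambda>\<omega>. \<Sum>j\<in>{1..p}. b i * b j * (?\<zeta> i \<omega> * ?\<zeta> j \<omega>))" if "i \<in> {1..p}" for i
      using that by (intro Bochner_Integration.integrable_sum integrable_mult_right prod_int)
    show "(\<Sum>i\<in>{1..p}. expectation (\<lambda>\<omega>. \<Sum>j\<in>{1..p}. b i * b j * (?\<zeta> i \<omega> * ?\<zeta> j \<omega>)))
      = (\<Sum>i\<in>{1..p}. \<Sum>j\<in>{1..p}. b i * b j * expectation (\<lambda>\<omega>. ?\<zeta> i \<omega> * ?\<zeta> j \<omega>))"
      by (intro sum.cong refl, subst Bochner_Integration.integral_sum)
        (auto intro!: integrable_mult_right prod_int)
  qed
  \<comment> \<open>Indices shift by one here, from \<open>{1..p}\<close> for the basis to matrix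
    positions below \<open>p\<close>.\<close>
  also have "\<dots> = (\<Sum>i<p. \<Sum>j<p. b (Suc i) * ?B $$ (i, j) * b (Suc j))"
    by (simp add: sum.atLeast1_atMost_eq cov_mat_def mult_ac)
  also have "\<dots> \<le> lambda_max ?B * (\<Sum>i<p. (b (Suc i))\<^sup>2)"
    by (rule quadratic_form_le_lambda_max[of ?B p "\<lambda>i. b (Suc i)"])
      (use p in \<open>auto simp: cov_mat_def mult.commute\<close>)
  also have "\<dots> \<le> lam * (\<Sum>i<p. (b (Suc i))\<^sup>2)"
    using lam by (intro mult_right_mono sum_nonneg) auto
  also have "(\<Sum>i<p. (b (Suc i))\<^sup>2) = ip {1..p} c c / real n"
    using n by (simp add: ip_def b_def power2_eq_square sum_divide_distrib sum.atLeast1_atMost_eq)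
  finally have var: "expectation (\<lambda>\<omega>. (Y \<omega>)\<^sup>2) \<le> lam / real n * ip {1..p} c c" by simp
  show "(\<integral>\<^sup>+\<omega>. ennreal (exp (Y \<omega>)) \<partial>M) \<le> ennreal (exp (lam / real n / 2 * ip {1..p} c c))"
    unfolding gaussian_rv_mgf[OF Y_gauss mean] using var by (intro ennreal_leI) simp
  show "(\<integral>\<^sup>+\<omega>. ennreal ((Y \<omega>)\<^sup>2) \<partial>M) \<le> ennreal (lam / real n * ip {1..p} c c)"
    using var gaussian_rv_square_integrable(2)[OF Y_gauss]
    by (subst nn_integral_eq_integral) (auto intro: ennreal_leI)
qed

section \<open>Transfer of the coordinate inequality to the regression model\<close>

theorem theorem5:
  fixes M :: "'a measure"
    and \<xi> y :: "real \<Rightarrow> 'a \<Rightarrow> real"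
    and S :: "real \<Rightarrow> real"
    and \<phi> :: "nat \<Rightarrow> nat \<Rightarrow> real \<Rightarrow> real"
    and n p :: nat
    and \<M> :: "nat set set"
    and l :: "nat set \<Rightarrow> real"
    and lam :: real
    and T :: "nat set \<Rightarrow> (nat \<Rightarrow> real) \<Rightarrow> real \<Rightarrow> real"
    and sel :: "(nat \<Rightarrow> real) \<Rightarrow> nat set"
  assumes "prob_space M"
    and "gaussian_noise M \<xi>"
    and "periodic_one S" and "square_integrable_unit S"
    and "regression_model M S \<xi> y"
    and "1 \<le> n" and "odd p"
    and "\<And>q. odd q \<Longrightarrow> orthonormal_basis_p q (\<phi> q)"
    and "\<M> \<subseteq> Pow {1..p}"
    and "\<And>m. m \<in> \<M> \<Longrightarrow> 1 \<le> l m"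
    and "\<And>m. m \<in> \<M> \<Longrightarrow> projective_estimator n p (\<phi> p) m (T m)"
    and "\<And>v. v \<in> space (obs_space n p) \<Longrightarrow>
           is_arg_min (\<lambda>m. contrast n p v (T m v) + penalty n lam l m) (\<lambda>m. m \<in> \<M>) (sel v)"
    and "jointly_gaussian M {1..p} (zeta (\<phi> p) \<xi> n p)"
    and "invertible_mat (cov_mat M (\<phi> p) \<xi> n p)"
    and "0 < lam"
    and "(SUP k\<in>{1..}. SUP q\<in>{q. odd q}. ereal (lambda_max (cov_mat M (\<phi> q) \<xi> k q))) \<le> ereal lam"
  shows "risk M n p y S (\<lambda>v. T (sel v) v) \<le>
     (INF m\<in>\<M>. 7 * risk M n p y S (T m)
               + ennreal (32 * lam * z_star * (l m * real (card m) / real n)))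
     + ennreal (8 * discr_H p S) + ennreal (2 * tau_0 \<M> l * lam / real n)"
proof -
  interpret prob_space M by fact
  have p: "0 < p" using \<open>odd p\<close> by (cases p) auto
  have n: "0 < n" using \<open>1 \<le> n\<close> by simp
  have basis: "orthonormal_basis_p p (\<phi> p)" using assms by simp
  note per = \<open>periodic_one S\<close> and sq = \<open>square_integrable_unit S\<close>
  have lam: "lambda_max (cov_mat M (\<phi> p) \<xi> n p) \<le> lam"
  proof -
    have "ereal (lambda_max (cov_mat M (\<phi> p) \<xi> n p)) \<le> (SUP q\<in>{q. odd q}. ereal (lambda_max (cov_mat M (\<phi> q) \<xi> n q)))"
      using \<open>odd p\<close> by (intro SUP_upper) auto
    also have "\<dots> \<le> (SUP k\<in>{1..}. SUP q\<in>{q. odd q}. ereal (lambda_max (cov_mat M (\<phi> q) \<xi> k q)))"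
      using \<open>1 \<le> n\<close> by (intro SUP_upper) auto
    also note assms(16)
    finally show ?thesis by simp
  qed
  define A where "A = {1..p}"
  define g where "g = cell_mean p S"
  define S' where "S' = coef p (\<phi> p) S"
  \<comment> \<open>The grid values of \<open>g - S\<close> are the errors \<open>discr_h\<close>,
    so Parseval identifies the squared length of \<open>h'\<close> with
    \<open>discr_H p S\<close>.\<close>
  define h' where "h' = coef p (\<phi> p) (\<lambda>t. g t - S t)"
  define \<nu> where "\<nu> j \<omega> = zeta (\<phi> p) \<xi> n p j \<omega> / sqrt (real n)" for j \<omega>
  define X where "X m \<omega> = coef p (\<phi> p) (T m (obs n p y \<omega>))" for m \<omega>
  define v where "v = lam / real n"
  have g_per: "periodic_one g" unfolding g_def by (rule periodic_cell_mean[OF per])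
  have obs_in: "obs n p y \<omega> \<in> space (obs_space n p)" for \<omega>
    by (simp add: obs_def obs_space_def space_PiM)
  have y_meas: "y t \<in> borel_measurable M" if "0 \<le> t" for t
    using \<open>regression_model M S \<xi> y\<close> that by (simp add: regression_model_def)
  have obs_meas [measurable]: "obs n p y \<in> M \<rightarrow>\<^sub>M obs_space n p"
    unfolding obs_def[abs_def] obs_space_def by (intro measurable_restrict y_meas) (simp add: grid_def)
  have T_space: "T m (obs n p y \<omega>) \<in> model_space (\<phi> p) m" if "m \<in> \<M>" for m \<omega>
    using assms(11)[OF that] obs_in by (auto simp: projective_estimator_def)
  have T_per: "periodic_one (T m (obs n p y \<omega>))" if "m \<in> \<M>" for m \<omega>
    using T_space[OF that, of \<omega>] \<open>\<M> \<subseteq> Pow {1..p}\<close> that basis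
    by (fastforce simp: model_space_def periodic_one_def orthonormal_basis_p_def intro!: sum.cong)
  have err: "normsq_p p (\<lambda>t. T m (obs n p y \<omega>) t - S t) = ip A (\<lambda>j. X m \<omega> j - S' j) (\<lambda>j. X m \<omega> j - S' j)"
    if "m \<in> \<M>" for m \<omega>
  proof -
    have "periodic_one (\<lambda>t. T m (obs n p y \<omega>) t - S t)"
      using T_per[OF that] per by (simp add: periodic_one_def)
    from parseval[OF basis this] show ?thesis
      by (simp add: normsq_p_def A_def X_def S'_def coef_diff[abs_def])
  qed
  have sel: "sel v \<in> \<M>" if "v \<in> space (obs_space n p)" for v
    using assms(12)[OF that] by (simp add: is_arg_min_def)
  have H: "discr_H p S = ip A h' h'"
  proof -
    have "periodic_one (\<lambda>t. g t - S t)" using g_per per by (simp add: periodic_one_def)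
    from parseval[OF basis this] have "ip A h' h' = inner_p p (\<lambda>t. g t - S t) (\<lambda>t. g t - S t)"
      by (simp add: h'_def A_def)
    also have "\<dots> = discr_H p S"
      unfolding discr_H_def inner_p_def g_def using discr_h_eq[OF per sq p]
      by (simp add: power2_eq_square)
    finally show ?thesis by simp
  qed
  have incr: "AE \<omega> in M. \<forall>k\<in>{1..n * p}. obs n p y \<omega> k - obs n p y \<omega> (k - 1) =
      g (grid p k) / real p + (\<xi> (grid p k) \<omega> - \<xi> (grid p (k - 1)) \<omega>)"
  proof -
    have "AE \<omega> in M. \<forall>t\<ge>0. y t \<omega> = y 0 \<omega> + (LINT s:{0..t}|lebesgue. S s) + (\<xi> t \<omega> - \<xi> 0 \<omega>)"
      using \<open>regression_model M S \<xi> y\<close> by (simp add: regression_model_def)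
    then show ?thesis
    proof eventually_elim
      case (elim \<omega>)
      show ?case
      proof
        fix k assume k: "k \<in> {1..n * p}"
        then have "obs n p y \<omega> k - obs n p y \<omega> (k - 1) = y (grid p k) \<omega> - y (grid p (k - 1)) \<omega>"
          by (auto simp: obs_def)
        also have "\<dots> = ((LINT s:{0..grid p k}|lebesgue. S s) - (LINT s:{0..grid p (k - 1)}|lebesgue. S s))
            + (\<xi> (grid p k) \<omega> - \<xi> (grid p (k - 1)) \<omega>)"
          using elim[rule_format, of "grid p k"] elim[rule_format, of "grid p (k - 1)"] by (simp add: grid_def)
        finally show "obs n p y \<omega> k - obs n p y \<omega> (k - 1) =
            g (grid p k) / real p + (\<xi> (grid p k) \<omega> - \<xi> (grid p (k - 1)) \<omega>)"
          using drift_increment[OF per sq p, of k] k by (simp add: g_def)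
      qed
    qed
  qed
  let ?pen = "\<lambda>m. v * (4 * z_star\<^sup>2 / (z_star - 1)) * (l m * real (card m))"
  have pen: "penalty n lam l m = ?pen m" for m
    by (simp add: penalty_def v_def mult_ac)
  have argmin: "AE \<omega> in M. \<forall>m\<in>\<M>.
      ip A (X (sel (obs n p y \<omega>)) \<omega>) (X (sel (obs n p y \<omega>)) \<omega>)
        - 2 * ip A (X (sel (obs n p y \<omega>)) \<omega>) (\<lambda>j. S' j + h' j + \<nu> j \<omega>) + ?pen (sel (obs n p y \<omega>))
      \<le> ip A (X m \<omega>) (X m \<omega>) - 2 * ip A (X m \<omega>) (\<lambda>j. S' j + h' j + \<nu> j \<omega>) + ?pen m"
    using incr
  proof eventually_elim
    case (elim \<omega>)
    let ?v = "obs n p y \<omega>"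
    have contrast: "contrast n p ?v (T m ?v) =
        ip A (X m \<omega>) (X m \<omega>) - 2 * ip A (X m \<omega>) (\<lambda>j. S' j + h' j + \<nu> j \<omega>)" if "m \<in> \<M>" for m
      unfolding A_def X_def S'_def h'_def \<nu>_def
      using \<open>\<M> \<subseteq> Pow {1..p}\<close> that elim
      by (intro contrast_in_coordinates[where m = m] basis T_space p n per g_per) auto
    have "contrast n p ?v (T (sel ?v) ?v) + penalty n lam l (sel ?v) \<le> contrast n p ?v (T m ?v) + penalty n lam l m"
      if "m \<in> \<M>" for m
      using assms(12)[OF obs_in] that by (auto simp: is_arg_min_def not_less)
    then show ?case using contrast sel[OF obs_in] unfolding pen by simp
  qed
  let ?f = "\<lambda>m. 7 * risk M n p y S (T m) + ennreal (32 * lam * z_star * (l m * real (card m) / real n))"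
  have bound: "risk M n p y S (\<lambda>v. T (sel v) v) \<le> ?f m + ennreal (8 * discr_H p S) + ennreal (2 * tau_0 \<M> l * lam / real n)"
    if m: "m \<in> \<M>" for m
  proof -
    have "(\<integral>\<^sup>+\<omega>. ennreal (ip A (\<lambda>j. X (sel (obs n p y \<omega>)) \<omega> j - S' j) (\<lambda>j. X (sel (obs n p y \<omega>)) \<omega> j - S' j)) \<partial>M)
    \<le> 7 * (\<integral>\<^sup>+\<omega>. ennreal (ip A (\<lambda>j. X m \<omega> j - S' j) (\<lambda>j. X m \<omega> j - S' j)) \<partial>M)
      + ennreal (32 * v * z_star * (l m * real (card m))) + ennreal (8 * ip A h' h')
      + ennreal (32 * z_star / (z_star - 1) * v * (\<Sum>m\<in>\<M>. exp (- (l m * real (card m)))))"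
    \<comment> \<open>The basis is numbered from 1, so 0 is free to label the direction of
      \<open>h'\<close>.\<close>
    proof (rule oracle_inequality_coordinates[where k = 0 and \<nu> = \<nu>, OF _ _ _ _ _ _ _ _ _ _ _ argmin m])
      show "finite A" "0 \<notin> A" "\<M> \<subseteq> Pow A" using assms(9) by (auto simp: A_def)
      show "0 < v" using \<open>0 < lam\<close> n by (simp add: v_def)
      show "\<And>c. (\<integral>\<^sup>+\<omega>. ennreal (exp (ip A c (\<lambda>j. \<nu> j \<omega>))) \<partial>M) \<le> ennreal (exp (v / 2 * ip A c c))"
        unfolding A_def \<nu>_def v_def using assms(2,13) lam p n by (rule noise_moments(1))
      show "\<And>c. (\<integral>\<^sup>+\<omega>. ennreal ((ip A c (\<lambda>j. \<nu> j \<omega>))\<^sup>2) \<partial>M) \<le> ennreal (v * ip A c c)"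
        unfolding A_def \<nu>_def v_def using assms(2,13) lam p n by (rule noise_moments(2))
      show "\<And>j. \<nu> j \<in> borel_measurable M"
        unfolding \<nu>_def[abs_def] using zeta_mean(1)[OF assms(2)] by measurable
      fix m' assume m': "m' \<in> \<M>"
      show "1 \<le> l m'" by (rule assms(10)[OF m'])
      have [measurable]: "(\<lambda>\<omega>. T m' (obs n p y \<omega>) (grid p j)) \<in> borel_measurable M" if "j \<in> {1..p}" for j
        using assms(11)[OF m'] that measurable_compose[OF obs_meas, of "\<lambda>v. T m' v (grid p j)" borel]
        by (auto simp: projective_estimator_def)
      \<comment> \<open>Measurability is read off the grid values, the form in which estimators are
        assumed measurable.\<close>
      show "(\<lambda>\<omega>. ip A (\<lambda>j. X m' \<omega> j - S' j) (\<lambda>j. X m' \<omega> j - S' j)) \<in> borel_measurable M"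
        unfolding err[OF m', symmetric] normsq_p_def inner_p_def by measurable
      fix \<omega> j assume j: "j \<in> A - m'"
      obtain c where "T m' (obs n p y \<omega>) = (\<lambda>t. \<Sum>i\<in>m'. c i * \<phi> p i t)"
        using T_space[OF m', of \<omega>] by (auto simp: model_space_def)
      then show "X m' \<omega> j = 0"
        using coef_combination[OF basis, of m' j c] assms(9) m' j by (auto simp: X_def A_def)
    qed (use sel obs_in in auto)
    also have "32 * v * z_star * (l m * real (card m)) = 32 * lam * z_star * (l m * real (card m) / real n)"
      by (simp add: v_def)
    also have "32 * z_star / (z_star - 1) * v * (\<Sum>m\<in>\<M>. exp (- (l m * real (card m)))) = 2 * tau_0 \<M> l * lam / real n"
      by (simp add: v_def tau_0_def l_star_def)
    finally show ?thesis
      unfolding risk_def using sel[OF obs_in] m by (simp add: err H)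
  qed
  \<comment> \<open>Over a finite nonempty family the infimum is attained, so the bound for each
    single \<open>m\<close> suffices.\<close>
  have "finite \<M>" using assms(9) by (simp add: finite_subset)
  moreover have "\<M> \<noteq> {}" using sel[OF obs_in] by blast
  ultimately have "(INF m\<in>\<M>. ?f m) \<in> ?f ` \<M>"
    using Min_in[of "?f ` \<M>"] by (simp add: Min_Inf)
  then obtain m where "m \<in> \<M>" "(INF m\<in>\<M>. ?f m) = ?f m" by auto
  with bound show ?thesis by simp
qed

end
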